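(* Let $A\in\mathbb{C}^{n\times n}$ be a partial isometry acting on $\mathbb{C}^n$. If $\dim\ker A=1$ and the numerical range $W(A)$ of $A$ is a circular disk, then this disk is centered at the origin.
   Context: A matrix $A\in\mathbb{C}^{n\times n}$ is a partial isometry if $\|Ax\|=\|x\|$ for all $x\in(\ker A)^\perp$ (Euclidean norm on $\mathbb{C}^n$). The numerical range of $A$ is $W(A)=\{\langle Ax,x\rangle : x\in\mathbb{C}^n,\ \|x\|=1\}\subset\mathbb{C}$. A circular disk is a closed disk in the complex plane. *)

theory Defs
  imports "HOL-Analysis.Analysis"
begin

(* The Hermitian inner product, linear in the first argument. The library's inner product
   on this type is real-valued (the real part of the one below), so it is not suitable for
   numerical ranges. The library's norm on complex ^ 'n is the Euclidean norm, see
   cinner_self. *)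
definition cinner :: "complex ^ 'n \<Rightarrow> complex ^ 'n \<Rightarrow> complex" where
  "cinner x y = (\<Sum>i\<in>UNIV. x $ i * cnj (y $ i))"

lemma cinner_self: "cinner x x = of_real ((norm x)\<^sup>2)"
proof -
  have "cinner x x = (\<Sum>i\<in>UNIV. of_real ((norm (x $ i))\<^sup>2))"
    unfolding cinner_def by (intro sum.cong refl) (metis complex_norm_square)
  also have "\<dots> = of_real (\<Sum>i\<in>UNIV. (norm (x $ i))\<^sup>2)"
    by simp
  also have "(\<Sum>i\<in>UNIV. (norm (x $ i))\<^sup>2) = (norm x)\<^sup>2"
    by (simp add: norm_vec_def L2_set_def sum_nonneg)
  finally show ?thesis .
qed

lemma Re_cinner: "Re (cinner x y) = inner x y"
  by (simp add: cinner_def inner_vec_def inner_complex_def)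

definition mat_ker :: "complex ^ 'n ^ 'n \<Rightarrow> (complex ^ 'n) set" where
  "mat_ker A = {x. A *v x = 0}"

definition ortho_compl :: "(complex ^ 'n) set \<Rightarrow> (complex ^ 'n) set" where
  "ortho_compl S = {x. \<forall>y\<in>S. cinner x y = 0}"

definition partial_isometry :: "complex ^ 'n ^ 'n \<Rightarrow> bool" where
  "partial_isometry A \<longleftrightarrow> (\<forall>x\<in>ortho_compl (mat_ker A). norm (A *v x) = norm x)"

definition numerical_range :: "complex ^ 'n ^ 'n \<Rightarrow> complex set" where
  "numerical_range A = {cinner (A *v x) x | x. norm x = 1}"

end

theory Submission
  imports Defs "HOL-Computational_Algebra.Fundamental_Theorem_Algebra"
begin

text \<open>Let \<open>e\<close> be a unit vector spanning the kernel of \<open>A\<close> and \<open>f\<close> a unit vector orthogonal to its range.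
A partial isometry satisfies \<open>\<langle>Ax, Ay\<rangle> = \<langle>x, y\<rangle> - \<langle>x, e\<rangle>\<langle>e, y\<rangle>\<close>, and this makes the scalar rational function
\<open>F(z) = z / \<langle>x\<^sub>z, e\<rangle>\<close> with \<open>x\<^sub>z = (z - A)\<inverse> f\<close> carry the whole geometry of the numerical range \<open>W(A)\<close>.

Assume first that \<open>A\<close> has no unimodular eigenvalue. Over a point \<open>w\<close> of the unit circle, the fibre of \<open>F\<close>
consists of \<open>n + 1\<close> distinct points of the unit circle, the eigenvalues of the unitary matrix with rows
\<open>(A, w f)\<close> and \<open>(e\<^sup>*, 0)\<close>, with the eigenvectors \<open>(w x\<^sub>z, 1)\<close>. As \<open>A\<close> is a compression of
this unitary, \<open>W(A)\<close> lies in the polygon whose vertices form the fibre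
(\<open>numerical_range_half_plane\<close>). It touches every side \<open>[\<alpha>, \<beta>]\<close>, at the mean of \<open>\<alpha>\<close> and \<open>\<beta>\<close> with
the weights \<open>u(\<alpha>)\<close> and \<open>u(\<beta>)\<close>, where \<open>u(z) = 1 + \<parallel>x\<^sub>z\<parallel>\<^sup>2\<close> (\<open>contact_point\<close>).

If \<open>W(A)\<close> is the disk with centre \<open>c\<close> and radius \<open>r\<close>, the point of contact is a point of tangency, and its
distance to a vertex \<open>z\<close> is the length of the tangent from \<open>z\<close>, whose square is \<open>\<bar>z - c\<bar>\<^sup>2 - r\<^sup>2\<close>. Hence
\<open>R(z) = u(z)\<^sup>2 (\<bar>z - c\<bar>\<^sup>2 - r\<^sup>2)\<close> agrees at neighbouring vertices, so it is constant on the fibre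
(\<open>weight_balance_on_fibre\<close>). On the unit circle \<open>u = z F'/F\<close> (\<open>weight_eq\<close>) and
\<open>\<bar>z - c\<bar>\<^sup>2 = (z - c)(1/z - cnj c)\<close>, so \<open>R\<close> is there the restriction of a rational function, and being
constant on the fibres this function factors through \<open>F\<close>. But \<open>F\<close> vanishes at \<open>0\<close> to order at least two,
because \<open>A\<close> is singular, so the order of \<open>R\<close> at \<open>0\<close> cannot be \<open>-1\<close>. If \<open>c \<noteq> 0\<close>, it
is \<open>-1\<close>: a contradiction. The comparison of orders is done by a polynomial identity
(\<open>jet_of_fibre_constant\<close>), so that \<open>R\<close> never has to be written as a function of \<open>F\<close>.

A unimodular eigenvalue \<open>\<zeta>\<close> splits off orthogonally and makes \<open>\<zeta>\<close> a corner of \<open>W(A)\<close>, which a disk of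
positive radius does not have (\<open>no_unimodular_eigenvalue_if_disk\<close>). A disk of radius zero is
\<open>{0}\<close>, since \<open>\<langle>Ae, e\<rangle> = 0\<close>.\<close>

section \<open>Circles and disks\<close>

text \<open>Used with the arguments of the vertices of a polygon inscribed in the unit circle: a quantity that
agrees at neighbouring vertices is the same at all of them.\<close>

lemma constant_on_finite_chain:
  fixes T :: "'a::linorder set"
  assumes "finite T"
    and "\<And>s t. s \<in> T \<Longrightarrow> t \<in> T \<Longrightarrow> s < t \<Longrightarrow> (\<forall>v\<in>T. v \<le> s \<or> t \<le> v) \<Longrightarrow> f s = f t"
    and "s \<in> T" "t \<in> T"
  shows "f s = f t"
proof -
  from assms(1,2) have "\<forall>s\<in>T. \<forall>t\<in>T. f s = f t"
  proof (induction T rule: finite_linorder_max_induct)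
    case empty
    then show ?case by simp
  next
    case (insert b T)
    have IH: "\<forall>s\<in>T. \<forall>t\<in>T. f s = f t"
    proof (rule insert.IH)
      fix s t assume "s \<in> T" "t \<in> T" "s < t" "\<forall>v\<in>T. v \<le> s \<or> t \<le> v"
      then show "f s = f t"
        using insert.hyps by (intro insert.prems) (auto intro: less_imp_le)
    qed
    show ?case
    proof (cases "T = {}")
      case False
      have "f (Max T) = f b"
        using insert.hyps False by (intro insert.prems) auto
      then show ?thesis
        using IH insert.hyps False Max_in[of T] by (metis insert_iff)
    qed simp
  qed
  with assms(3,4) show ?thesis by blast
qed

text \<open>It contains the \<open>n\<close>-th roots of unity for every \<open>n\<close>.\<close>

lemma infinite_unit_circle: "infinite {w :: complex. cmod w = 1}"
proof
  let ?C = "{w :: complex. cmod w = 1}"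
  assume fin: "finite ?C"
  have "{z :: complex. z ^ Suc (card ?C) = 1} \<subseteq> ?C"
    using power_eq_imp_eq_norm[of _ "Suc (card ?C)" 1] by auto
  then have "card {z :: complex. z ^ Suc (card ?C) = 1} \<le> card ?C"
    by (rule card_mono[OF fin])
  then show False using card_roots_unity_eq[of "Suc (card ?C)"] by simp
qed

lemma unimodular_mult_cnj: "cmod z = 1 \<Longrightarrow> z * cnj z = 1"
  using complex_norm_square[of z] by simp

lemma rotation_ne:
  assumes "cmod z = 1"
  shows "z * cis (1 / (real k + 1)) \<noteq> z"
proof
  assume "z * cis (1 / (real k + 1)) = z"
  moreover have "z \<noteq> 0" using assms by auto
  ultimately have "cis (1 / (real k + 1)) = 1" by simp
  then have "sin (1 / (real k + 1)) = 0" by (metis cis.sel(2) one_complex.sel(2))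
  moreover have "sin (1 / (real k + 1)) > 0"
    using pi_gt3 by (intro sin_gt_zero) (auto intro: le_less_trans[of _ 1])
  ultimately show False by simp
qed

lemma rotation_tendsto: "(\<lambda>k. z * cis (1 / (real k + 1))) \<longlonglongrightarrow> z"
proof -
  have "(\<lambda>k. 1 / (real k + 1)) \<longlonglongrightarrow> 0"
    using LIMSEQ_inverse_real_of_nat by (simp add: inverse_eq_divide add.commute)
  then have "(\<lambda>k. cis (1 / (real k + 1))) \<longlonglongrightarrow> cis 0"
    unfolding cis_conv_exp by (intro tendsto_intros)
  then have "(\<lambda>k. z * cis (1 / (real k + 1))) \<longlonglongrightarrow> z * cis 0"
    by (rule tendsto_mult_left)
  then show ?thesis by simp
qed

lemma cos_le_cos_outside:
  assumes "0 < d" "d < pi" "d \<le> \<bar>x\<bar>" "\<bar>x\<bar> \<le> 2 * pi - d"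
  shows "cos x \<le> cos d"
proof (cases "\<bar>x\<bar> \<le> pi")
  case True
  then have "cos \<bar>x\<bar> \<le> cos d" using assms by (intro cos_monotone_0_pi_le) auto
  then show ?thesis by simp
next
  case False
  then have "cos (2 * pi - \<bar>x\<bar>) \<le> cos d" using assms by (intro cos_monotone_0_pi_le) auto
  then show ?thesis by (simp add: cos_diff)
qed

lemma disk_half_plane:
  assumes "cmod \<omega> = 1" "p \<in> cball c r"
  shows "Re (cnj \<omega> * p) \<le> Re (cnj \<omega> * c) + r"
proof -
  have "Re (cnj \<omega> * (p - c)) \<le> cmod (cnj \<omega> * (p - c))" by (rule complex_Re_le_cmod)
  also have "\<dots> \<le> r" using assms by (simp add: norm_mult dist_norm norm_minus_commute)
  finally show ?thesis by (simp add: algebra_simps)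
qed

text \<open>Equality in the Cauchy-Schwarz inequality: a disk meets each of its tangent lines in one point.\<close>

lemma disk_support_point:
  assumes "cmod \<omega> = 1" "p \<in> cball c r" "0 \<le> r" "r \<le> Re (cnj \<omega> * (p - c))"
  shows "p = c + of_real r * \<omega>"
proof -
  have "(cmod (p - c - of_real r * \<omega>))\<^sup>2 = (cmod (p - c))\<^sup>2 - 2 * r * Re (cnj \<omega> * (p - c)) + r\<^sup>2 * (cmod \<omega>)\<^sup>2"
    unfolding cmod_power2 by (simp add: power2_eq_square algebra_simps)
  moreover have "r * r \<le> r * Re (cnj \<omega> * (p - c))" using assms(4,3) by (rule mult_left_mono)
  moreover have "(cmod (p - c))\<^sup>2 \<le> r\<^sup>2"
    using assms(2) by (intro power_mono) (simp_all add: dist_norm norm_minus_commute)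
  ultimately have "(cmod (p - c - of_real r * \<omega>))\<^sup>2 \<le> 0"
    using assms(1) by (simp add: power2_eq_square)
  then show ?thesis by (simp add: algebra_simps)
qed

lemma unimodular_eqI:
  assumes "cmod \<omega> = 1" "cmod \<zeta> = 1" "1 \<le> Re (cnj \<omega> * \<zeta>)"
  shows "\<omega> = \<zeta>"
  using disk_support_point[of \<omega> \<zeta> 0 1] assms by simp

section \<open>Functions constant on the fibres of a rational function\<close>

text \<open>Reduction modulo a monic polynomial uses no division of coefficients, so the remainders modulo the members
of the pencil \<open>P - w Q\<close> depend polynomially on \<open>w\<close>. Induction on \<open>X\<close>: appending a coefficient shifts
the remainder, and one multiple of the modulus removes the overflow.\<close>

lemma coeff_mod_pencil:
  fixes P Q X :: "complex poly"
  assumes deg: "degree Q < degree P" and monic: "lead_coeff P = 1"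
  shows "\<exists>c. \<forall>w. coeff (X mod (P - smult w Q)) i = poly c w"
proof -
  define N where "N = degree P"
  have N: "N > 0" using deg by (simp add: N_def)
  have pd: "degree (P - smult w Q) = N" for w
  proof -
    have "degree (- smult w Q) < degree P" using deg by (simp add: degree_smult_le le_less_trans)
    from degree_add_eq_left[OF this] show ?thesis by (simp add: N_def)
  qed
  have pl: "coeff (P - smult w Q) N = 1" for w
    using deg monic by (simp add: N_def coeff_eq_0)
  have "\<exists>c. \<forall>w i. coeff (X mod (P - smult w Q)) i = poly (c i) w"
  proof (induction X rule: pCons_induct)
    case 0
    show ?case by (rule exI[of _ "\<lambda>i. 0"]) simp
  next
    case (pCons b X)
    then obtain c where c: "\<And>w i. coeff (X mod (P - smult w Q)) i = poly (c i) w" by blast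
    have p0: "P - smult w Q \<noteq> 0" for w using pl[of w] by auto
    define d where "d i = (case i of 0 \<Rightarrow> [:b:] | Suc k \<Rightarrow> c k) - c (N - 1) * [:coeff P i, - coeff Q i:]" for i
    have "coeff (pCons b X mod (P - smult w Q)) i = poly (d i) w" for w i
    proof -
      have "pCons b X mod (P - smult w Q) =
          pCons b (X mod (P - smult w Q)) - smult (coeff (X mod (P - smult w Q)) (N - 1)) (P - smult w Q)"
        using p0[of w] pl[of w] N pd[of w]
        by (cases N) (simp_all add: mod_pCons Let_def)
      then have "coeff (pCons b X mod (P - smult w Q)) i =
          (case i of 0 \<Rightarrow> b | Suc k \<Rightarrow> poly (c k) w) - poly (c (N - 1)) w * (coeff P i - w * coeff Q i)"
        by (simp add: c coeff_pCons split: nat.splits)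
      also have "\<dots> = poly (d i) w"
        by (simp add: d_def algebra_simps split: nat.splits)
      finally show ?thesis .
    qed
    then show ?case by blast
  qed
  then show ?thesis by blast
qed

lemma card_roots_eq_degree:
  fixes p :: "complex poly"
  assumes "p \<noteq> 0" "\<And>z. poly p z = 0 \<Longrightarrow> poly (pderiv p) z \<noteq> 0"
  shows "card {z. poly p z = 0} = degree p"
proof -
  have "rsquarefree p" using assms by (auto simp: rsquarefree_roots)
  then have eq: "smult (lead_coeff p) (\<Prod>z|poly p z = 0. [:-z, 1:]) = p"
    by (rule complex_poly_decompose_rsquarefree)
  have "degree (\<Prod>z|poly p z = 0. [:-z, 1:]) = (\<Sum>z|poly p z = 0. degree [:-z, 1:])"
    by (rule degree_prod_eq_sum_degree) simp
  also have "\<dots> = card {z. poly p z = 0}" by simp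
  finally show ?thesis using arg_cong[OF eq, of degree] assms(1) by simp
qed

text \<open>A ratio \<open>X / Y\<close> that is constant on the fibres of \<open>P / Q\<close> over infinitely many points is a function of
\<open>P / Q\<close>. If moreover \<open>P\<close> vanishes twice at \<open>0\<close>, the ratio has to be stationary there, which is the
conclusion in a form that allows \<open>Y\<close> to vanish at \<open>0\<close>. In terms of remainders: on a fibre with
simple points, \<open>X\<close> and \<open>Y\<close> have proportional remainders modulo \<open>P - w Q\<close>. The minors that express
this are polynomials in \<open>w\<close>, so they vanish for \<open>w = 0\<close> as well, and modulo \<open>P\<close> the two lowest
coefficients of a polynomial are unchanged.\<close>

lemma jet_of_fibre_constant:
  fixes P Q X Y :: "complex poly"
  assumes deg: "degree Q < degree P" and monic: "lead_coeff P = 1"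
    and double: "coeff P 0 = 0" "coeff P 1 = 0"
    and W: "infinite W"
    and simple: "\<And>w z. w \<in> W \<Longrightarrow> poly (P - smult w Q) z = 0 \<Longrightarrow> poly (pderiv (P - smult w Q)) z \<noteq> 0"
    and const: "\<And>w. w \<in> W \<Longrightarrow> \<exists>k. \<forall>z. poly (P - smult w Q) z = 0 \<longrightarrow> poly X z = k * poly Y z"
  shows "coeff X 0 * coeff Y 1 = coeff X 1 * coeff Y 0"
proof -
  have pd: "degree (P - smult w Q) = degree P" for w
  proof -
    have "degree (- smult w Q) < degree P" using deg by (simp add: degree_smult_le le_less_trans)
    from degree_add_eq_left[OF this] show ?thesis by simp
  qed
  have p0: "P - smult w Q \<noteq> 0" for w using pd[of w] deg by auto
  obtain x0 where x0: "\<And>w. coeff (X mod (P - smult w Q)) 0 = poly x0 w"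
    using coeff_mod_pencil[OF deg monic] by metis
  obtain x1 where x1: "\<And>w. coeff (X mod (P - smult w Q)) 1 = poly x1 w"
    using coeff_mod_pencil[OF deg monic] by metis
  obtain y0 where y0: "\<And>w. coeff (Y mod (P - smult w Q)) 0 = poly y0 w"
    using coeff_mod_pencil[OF deg monic] by metis
  obtain y1 where y1: "\<And>w. coeff (Y mod (P - smult w Q)) 1 = poly y1 w"
    using coeff_mod_pencil[OF deg monic] by metis
  \<comment> \<open>The minor of the coefficients 0 and 1 vanishes because \<open>X - k Y\<close> vanishes at all roots of the modulus.\<close>
  have zero: "poly (x0 * y1 - x1 * y0) w = 0" if w: "w \<in> W" for w
  proof -
    let ?p = "P - smult w Q"
    obtain k where k: "\<And>z. poly ?p z = 0 \<Longrightarrow> poly X z = k * poly Y z" using const[OF w] by blast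
    have "?p dvd X - smult k Y"
    proof -
      let ?r = "(X - smult k Y) mod ?p"
      have "?r = 0"
      proof (rule ccontr)
        assume r: "?r \<noteq> 0"
        have "poly ?r z = 0" if "poly ?p z = 0" for z
          using k[OF that] that by (simp add: poly_mod)
        then have "{z. poly ?p z = 0} \<subseteq> {z. poly ?r z = 0}" by blast
        then have "card {z. poly ?p z = 0} \<le> card {z. poly ?r z = 0}"
          using r by (intro card_mono poly_roots_finite) auto
        also have "\<dots> \<le> degree ?r" using r by (rule card_poly_roots_bound)
        also have "\<dots> < degree ?p" using r p0[of w] by (metis degree_mod_less)
        finally show False using card_roots_eq_degree[OF p0[of w] simple[OF w]] by simp
      qed
      then show ?thesis by (simp add: mod_eq_0_iff_dvd)
    qed
    then have "X mod ?p = smult k (Y mod ?p)"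
      by (metis mod_eq_dvd_iff mod_smult_left)
    then show ?thesis
      by (simp flip: x0 x1 y0 y1)
  qed
  have "x0 * y1 - x1 * y0 = 0"
  proof (rule ccontr)
    assume "x0 * y1 - x1 * y0 \<noteq> 0"
    then have "finite {w. poly (x0 * y1 - x1 * y0) w = 0}" by (rule poly_roots_finite)
    moreover have "W \<subseteq> {w. poly (x0 * y1 - x1 * y0) w = 0}" using zero by blast
    ultimately show False using W finite_subset by blast
  qed
  then have "poly (x0 * y1 - x1 * y0) 0 = 0" by simp
  then have *: "poly x0 0 * poly y1 0 = poly x1 0 * poly y0 0" by simp
  \<comment> \<open>At \<open>w = 0\<close> the modulus is \<open>P\<close>, a multiple of the square of the variable.\<close>
  have low: "coeff (Z mod P) i = coeff Z i" if "i \<le> 1" for Z i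
  proof -
    have "coeff (P * (Z div P)) i = 0"
      using that double by (auto simp: coeff_mult le_Suc_eq)
    moreover have "Z = P * (Z div P) + Z mod P" by simp
    ultimately show ?thesis using coeff_add[of "P * (Z div P)" "Z mod P" i] by simp
  qed
  show ?thesis
    using * x0[of 0] x1[of 0] y0[of 0] y1[of 0] by (simp add: low)
qed

section \<open>The Hermitian inner product\<close>

lemma cinner_add_left: "cinner (x + y) z = cinner x z + cinner y z"
  and cinner_add_right: "cinner z (x + y) = cinner z x + cinner z y"
  by (simp_all add: cinner_def algebra_simps sum.distrib)

lemma cinner_diff_left: "cinner (x - y) z = cinner x z - cinner y z"
  and cinner_diff_right: "cinner z (x - y) = cinner z x - cinner z y"
  by (simp_all add: cinner_def algebra_simps sum_subtractf)

lemma cinner_scale_left: "cinner (k *s x) z = k * cinner x z"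
  and cinner_scale_right: "cinner z (k *s x) = cnj k * cinner z x"
  by (simp_all add: cinner_def algebra_simps sum_distrib_left)

lemma cinner_zero [simp]: "cinner 0 z = 0" "cinner z 0 = 0"
  by (simp_all add: cinner_def)

lemma cnj_cinner: "cnj (cinner x y) = cinner y x"
  by (simp add: cinner_def mult.commute)

lemma cinner_sum_left: "cinner (\<Sum>i\<in>I. f i) z = (\<Sum>i\<in>I. cinner (f i) z)"
  by (induction I rule: infinite_finite_induct) (simp_all add: cinner_add_left)

lemma cinner_sum_right: "cinner z (\<Sum>i\<in>I. f i) = (\<Sum>i\<in>I. cinner z (f i))"
  by (induction I rule: infinite_finite_induct) (simp_all add: cinner_add_right)

lemmas cinner_linear = cinner_add_left cinner_add_right cinner_diff_left cinner_diff_right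
  cinner_scale_left cinner_scale_right

lemma norm_vec_scale: "norm (k *s (x :: complex ^ 'n)) = norm k * norm x"
proof -
  have "of_real ((norm (k *s x))\<^sup>2) = k * cnj k * of_real ((norm x)\<^sup>2)"
    unfolding cinner_self[symmetric] by (simp add: cinner_linear)
  also have "\<dots> = (of_real ((norm k * norm x)\<^sup>2) :: complex)"
    by (simp only: power_mult_distrib of_real_mult complex_norm_square)
  finally have "of_real ((norm (k *s x))\<^sup>2) = (of_real ((norm k * norm x)\<^sup>2) :: complex)" .
  then have "(norm (k *s x))\<^sup>2 = (norm k * norm x)\<^sup>2" by (simp only: of_real_eq_iff)
  then show ?thesis by (simp add: power2_eq_iff_nonneg)
qed

lemma cmod_cinner_le: "cmod (cinner x y) \<le> norm x * norm y"
proof -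
  let ?z = "cinner x y"
  define u where "u = cnj (sgn ?z)"
  have "u * ?z = of_real (cmod ?z)"
    by (cases "?z = 0") (simp_all add: u_def sgn_eq complex_norm_square[symmetric] power2_eq_square mult.commute)
  then have "cmod ?z = Re (cinner (u *s x) y)" by (simp add: cinner_linear)
  also have "\<dots> \<le> norm (u *s x) * norm y"
    unfolding Re_cinner by (rule norm_cauchy_schwarz)
  also have "norm (u *s x) \<le> norm x"
    by (simp add: norm_vec_scale u_def norm_sgn)
  finally show ?thesis by (simp add: mult_right_mono)
qed

text \<open>The polarization argument, by which a sesquilinear identity over the complex numbers need only be checked on
the diagonal.\<close>

lemma sesquilinear_eq_0I:
  fixes B :: "complex ^ 'n \<Rightarrow> complex ^ 'n \<Rightarrow> complex"
  assumes add: "\<And>x y z. B (x + y) z = B x z + B y z" "\<And>x y z. B z (x + y) = B z x + B z y"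
    and scale: "\<And>k x y. B (k *s x) y = k * B x y" "\<And>k x y. B x (k *s y) = cnj k * B x y"
    and diag: "\<And>x. B x x = 0"
  shows "B x y = 0"
proof -
  have "B x y + B y x = B (x + y) (x + y) - B x x - B y y"
    by (simp add: add)
  then have 1: "B x y + B y x = 0" by (simp add: diag)
  have "B x (\<i> *s y) + B (\<i> *s y) x = 0"
    using diag[of "x + \<i> *s y"] diag[of x] diag[of y] by (simp add: add scale)
  then have "\<i> * (B y x - B x y) = 0" by (simp add: scale algebra_simps)
  then have "B y x = B x y" by simp
  with 1 show ?thesis by simp
qed

lemma scaled_quotient_in_numerical_range:
  assumes "v \<noteq> 0"
  shows "cinner (A *v v) v / of_real ((norm v)\<^sup>2) \<in> numerical_range A"
proof -
  define k where "k = complex_of_real (1 / norm v)"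
  have "norm (k *s v) = 1" using assms by (simp add: norm_vec_scale k_def norm_divide)
  moreover have "cinner (A *v (k *s v)) (k *s v) = (k * cnj k) * cinner (A *v v) v"
    by (simp add: vec.scale cinner_linear)
  moreover have "k * cnj k = 1 / of_real ((norm v)\<^sup>2)"
    by (simp add: k_def power2_eq_square)
  ultimately show ?thesis unfolding numerical_range_def by (auto intro!: exI[of _ "k *s v"])
qed

lemma tendsto_cinner:
  assumes "((g :: 'b \<Rightarrow> complex ^ 'm) \<longlongrightarrow> x) F" "(h \<longlongrightarrow> y) F"
  shows "((\<lambda>t. cinner (g t) (h t)) \<longlongrightarrow> cinner x y) F"
  unfolding cinner_def by (intro tendsto_intros assms)

lemma tendsto_matrix_vector_mult:
  assumes "(g \<longlongrightarrow> x) F"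
  shows "((\<lambda>t. (A :: complex ^ 'n ^ 'm) *v g t) \<longlongrightarrow> A *v x) F"
  by (rule vec_tendstoI) (simp add: matrix_vector_mult_def tendsto_intros assms)

section \<open>Determinants and characteristic polynomials\<close>

lemma det_eq_0_iff_kernel:
  fixes M :: "complex ^ 'n ^ 'n"
  shows "det M = 0 \<longleftrightarrow> (\<exists>x. x \<noteq> 0 \<and> M *v x = 0)"
proof -
  have "det M \<noteq> 0 \<longleftrightarrow> (\<forall>x. M *v x = 0 \<longrightarrow> x = 0)"
    by (simp only: invertible_det_nz[symmetric] invertible_left_inverse matrix_left_invertible_ker)
  then show ?thesis by auto
qed

lemma tendsto_det:
  fixes M :: "complex ^ 'm ^ 'm" and N :: "'b \<Rightarrow> complex ^ 'm ^ 'm"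
  assumes "\<And>i j. ((\<lambda>t. N t $ i $ j) \<longlongrightarrow> M $ i $ j) F"
  shows "((\<lambda>t. det (N t)) \<longlongrightarrow> det M) F"
  unfolding det_def by (intro tendsto_sum tendsto_mult tendsto_const tendsto_prod assms)

lemma scalar_matrix_vector_mult: "mat k *v (x :: 'a::comm_ring_1 ^ 'n) = k *s x"
  by (simp add: matrix_vector_mult_def mat_def vec_eq_iff if_distrib[where f = "\<lambda>a. a * _"] cong: if_cong)

definition outer_mat :: "complex ^ 'n \<Rightarrow> complex ^ 'n \<Rightarrow> complex ^ 'n ^ 'n" where
  "outer_mat x y = (\<chi> i j. x $ i * cnj (y $ j))"

lemma outer_mat_mult_vec: "outer_mat x y *v v = cinner v y *s x"
  by (simp add: outer_mat_def matrix_vector_mult_def cinner_def vec_eq_iff sum_distrib_left algebra_simps)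

text \<open>The identity matrix with one column replaced by \<open>x\<close> is invertible if the right column is chosen, and it
conjugates the given matrix into one that differs from the identity in a single row only. Both determinants
are then instances of Cramer's rule.\<close>

lemma det_mat_1_minus_outer: "det (mat 1 - outer_mat x y) = 1 - cinner x y"
proof (cases "x = 0")
  case True
  then have "outer_mat x y = 0" by (simp add: outer_mat_def vec_eq_iff)
  then show ?thesis using True by simp
next
  case False
  then obtain k where k: "x $ k \<noteq> 0" by (auto simp: vec_eq_iff)
  define M :: "complex ^ 'a ^ 'a" where "M = (\<chi> i j. if j = k then x $ i else mat 1 $ i $ j)"
  have detM: "det M = x $ k"
    using cramer_lemma[of k "mat 1" x] unfolding matrix_vector_mul_lid M_def by simp
  define v where "v = (\<chi> j. (\<Sum>i\<in>UNIV. cnj (y $ i) * M $ i $ j))"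
  define R :: "complex ^ 'a ^ 'a" where "R = (\<chi> i. if i = k then axis k 1 - v else row i (mat 1))"
  have "det R = (axis k 1 - v) $ k * det (mat 1 :: complex ^ 'a ^ 'a)"
  proof -
    have "(\<Sum>i\<in>UNIV. u $ i *s row i (mat 1)) = u" for u :: "complex ^ 'a"
      by (simp add: vec_eq_iff row_def mat_def if_distrib cong: if_cong)
    then show ?thesis
      using cramer_lemma_transpose[of k "axis k 1 - v" "mat 1"] unfolding R_def by (simp only:)
  qed
  moreover have "v $ k = cinner x y"
    by (simp add: v_def M_def cinner_def mult.commute)
  ultimately have detR: "det R = 1 - cinner x y" by simp
  have "(mat 1 - outer_mat x y) ** M = M ** R"
  proof -
    have l: "((mat 1 - outer_mat x y) ** M) $ i $ j = M $ i $ j - x $ i * v $ j" for i j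
    proof -
      have "((mat 1 - outer_mat x y) ** M) $ i $ j = (\<Sum>l\<in>UNIV. (mat 1 $ i $ l - x $ i * cnj (y $ l)) * M $ l $ j)"
        by (simp add: matrix_matrix_mult_def outer_mat_def)
      also have "\<dots> = (\<Sum>l\<in>UNIV. (if l = i then M $ i $ j else 0) - x $ i * (cnj (y $ l) * M $ l $ j))"
        by (intro sum.cong refl) (auto simp: mat_def algebra_simps)
      also have "\<dots> = (\<Sum>l\<in>UNIV. (if l = i then M $ i $ j else 0)) - x $ i * v $ j"
        by (simp add: sum_subtractf v_def sum_distrib_left)
      finally show ?thesis by simp
    qed
    have r: "(M ** R) $ i $ j = M $ i $ j - x $ i * v $ j" for i j
    proof -
      have R: "R $ l $ j = (if l = j then 1 else 0) - (if l = k then v $ j else 0)" for l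
        by (auto simp: R_def row_def mat_def axis_def)
      have "(M ** R) $ i $ j = (\<Sum>l\<in>UNIV. (if l = j then M $ i $ j else 0) - (if l = k then M $ i $ k * v $ j else 0))"
        by (simp add: matrix_matrix_mult_def R if_distrib algebra_simps) (intro sum.cong refl, auto simp: algebra_simps)
      also have "\<dots> = M $ i $ j - M $ i $ k * v $ j" by (simp add: sum_subtractf)
      finally show ?thesis by (simp add: M_def)
    qed
    show ?thesis by (simp add: vec_eq_iff l r)
  qed
  then have "det (mat 1 - outer_mat x y) * det M = det M * det R"
    by (metis det_mul)
  then show ?thesis using k by (simp add: detM detR)
qed

text \<open>The determinant is taken over the ring of polynomials, so that \<open>det (z - A)\<close> is available as a polynomial
and can be differentiated and factored.\<close>

definition char_poly :: "complex ^ 'n ^ 'n \<Rightarrow> complex poly" where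
  "char_poly A = det (\<chi> i j. [:- A $ i $ j, if i = j then 1 else 0:])"

lemma poly_char_poly: "poly (char_poly A) z = det (mat z - A)"
  unfolding char_poly_def det_def
  by (simp add: poly_sum poly_prod mat_def if_distrib cong: if_cong)
     (intro sum.cong prod.cong arg_cong2[where f = "(*)"] refl, auto)

lemma monic_char_poly:
  fixes A :: "complex ^ 'n ^ 'n"
  shows degree_char_poly: "degree (char_poly A) = CARD('n)"
    and lead_coeff_char_poly: "lead_coeff (char_poly A) = 1"
proof -
  define q where "q p i = [:- A $ i $ p i, if i = p i then 1 else 0:]" for p :: "'n \<Rightarrow> 'n" and i
  define t where "t p = of_int (sign p) * prod (q p) UNIV" for p
  let ?S = "{p. p permutes (UNIV :: 'n set)}"
  have fin: "finite ?S" by (rule finite_permutations) simp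
  have id: "id \<in> ?S" by (simp add: permutes_id)
  have "char_poly A = sum t ?S"
    by (simp add: char_poly_def det_def t_def q_def)
  then have split: "char_poly A = t id + sum t (?S - {id})"
    using fin id by (simp add: sum.remove)
  have tid: "t id = (\<Prod>i\<in>UNIV. [:- A $ i $ i, 1:])"
    by (simp add: t_def q_def sign_id)
  have d1: "degree (t id) = CARD('n)"
    unfolding tid by (subst degree_prod_eq_sum_degree) simp_all
  have l1: "lead_coeff (t id) = 1"
    unfolding tid by (simp add: lead_coeff_prod)
  \<comment> \<open>A permutation other than the identity moves some index, and the factor at that index is constant.\<close>
  have d2: "degree (sum t (?S - {id})) < CARD('n)"
  proof (rule degree_sum_less)
    fix p assume p: "p \<in> ?S - {id}"
    then obtain k where k: "p k \<noteq> k" by (metis DiffE eq_id_iff insertI1)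
    have "degree (t p) \<le> degree (of_int (sign p) :: complex poly) + degree (prod (q p) UNIV)"
      unfolding t_def by (rule degree_mult_le)
    also have "\<dots> = degree (prod (q p) UNIV)" by simp
    also have "\<dots> \<le> (\<Sum>i\<in>UNIV. degree (q p i))"
      using degree_prod_sum_le[of UNIV "q p"] by simp
    also have "\<dots> < (\<Sum>i\<in>(UNIV :: 'n set). 1)"
      by (rule sum_strict_mono_ex1) (use k in \<open>auto simp: q_def intro!: exI[of _ k]\<close>)
    finally show "degree (t p) < CARD('n)" by simp
  qed simp
  show "degree (char_poly A) = CARD('n)"
    unfolding split using d1 d2 by (simp add: degree_add_eq_left)
  show "lead_coeff (char_poly A) = 1"
    unfolding split using d1 d2 l1 by (simp add: degree_add_eq_left coeff_eq_0)
qed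

section \<open>Partial isometries with one-dimensional kernel\<close>

text \<open>The vectors \<open>e\<close> and \<open>f\<close> span the kernel and the orthogonal complement of the range of \<open>A\<close>. The assumption
\<open>defect\<close> says that \<open>1 - A\<^sup>* A\<close> is the orthogonal projection onto the span of \<open>e\<close>.\<close>

locale defect_one =
  fixes A :: "complex ^ 'n ^ 'n" and e f :: "complex ^ 'n"
  assumes cinner_e: "cinner e e = 1"
    and cinner_f: "cinner f f = 1"
    and A_e: "A *v e = 0"
    and defect: "cinner (A *v x) (A *v y) = cinner x y - cinner x e * cinner e y"
    and range_perp_f: "cinner (A *v x) f = 0"

text \<open>The identity \<open>defect\<close> for \<open>x = y\<close> is the definition of a partial isometry, applied to the component of \<open>x\<close> orthogonal
to \<open>e\<close>; it extends by polarization. The kernel of the transpose, conjugated, provides \<open>f\<close>.\<close>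

lemma partial_isometry_defect_one:
  fixes A :: "complex ^ 'n ^ 'n"
  assumes A: "partial_isometry A" and dim: "vec.dim (mat_ker A) = 1"
  shows "\<exists>e f. defect_one A e f"
proof -
  obtain B where B: "B \<subseteq> mat_ker A" "vec.independent B" "mat_ker A \<subseteq> vec.span B" "card B = 1"
    using vec.basis_exists[of "mat_ker A"] dim by metis
  then obtain b where b: "B = {b}" by (auto simp: card_1_singleton_iff)
  have b0: "b \<noteq> 0" using B(2) vec.dependent_zero unfolding b by blast
  define e where "e = of_real (1 / norm b) *s b"
  have ne: "norm e = 1" using b0 by (simp add: e_def norm_vec_scale norm_divide)
  have ee: "cinner e e = 1" using ne by (simp add: cinner_self)
  have be: "b = of_real (norm b) *s e" using b0 by (simp add: e_def)
  have Ab: "A *v b = 0" using B(1) by (simp add: b mat_ker_def)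
  have Ae: "A *v e = 0" by (simp add: e_def vec.scale Ab)
  have ker: "\<exists>k. v = k *s e" if v: "v \<in> mat_ker A" for v
  proof -
    obtain k where "v = k *s b" using v B(3) unfolding b vec.span_singleton by blast
    then show ?thesis using be by (metis vec.scale_scale)
  qed
  have quad: "cinner (A *v v) (A *v v) = cinner v v - cinner v e * cinner e v" for v
  proof -
    define u where "u = v - cinner v e *s e"
    have ue: "cinner u e = 0" by (simp add: u_def cinner_linear ee)
    have "cinner u y = 0" if y: "y \<in> mat_ker A" for y
      using ker[OF y] ue by (auto simp: cinner_linear)
    then have "u \<in> ortho_compl (mat_ker A)" by (simp add: ortho_compl_def)
    then have "norm (A *v u) = norm u" using A by (simp add: partial_isometry_def)
    moreover have "A *v u = A *v v" by (simp add: u_def vec.diff vec.scale Ae)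
    ultimately have "cinner (A *v v) (A *v v) = cinner u u" by (simp add: cinner_self)
    also have "\<dots> = cinner v v - cinner v e * cinner e v"
      by (simp add: u_def cinner_linear ee cnj_cinner)
    finally show ?thesis .
  qed
  have form: "cinner (A *v x) (A *v y) = cinner x y - cinner x e * cinner e y" for x y
  proof -
    define D where "D x y = cinner (A *v x) (A *v y) - (cinner x y - cinner x e * cinner e y)" for x y
    have "D x y = 0"
      by (rule sesquilinear_eq_0I)
        (simp_all add: D_def quad cinner_linear vec.add vec.scale algebra_simps)
    then show ?thesis by (simp add: D_def)
  qed
  have "det A = 0" unfolding det_eq_0_iff_kernel using Ab b0 by blast
  then have "det (transpose A) = 0" by simp
  then obtain g where g: "g \<noteq> 0" "transpose A *v g = 0" unfolding det_eq_0_iff_kernel by blast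
  define f0 where "f0 = (\<chi> i. cnj (g $ i))"
  have f0: "f0 \<noteq> 0" using g(1) by (simp add: f0_def vec_eq_iff)
  have perp: "cinner (A *v v) f0 = 0" for v
  proof -
    have "cinner (A *v v) f0 = (\<Sum>i\<in>UNIV. \<Sum>j\<in>UNIV. A $ i $ j * v $ j * g $ i)"
      by (simp add: cinner_def f0_def matrix_vector_mult_def sum_distrib_right)
    also have "\<dots> = (\<Sum>j\<in>UNIV. \<Sum>i\<in>UNIV. A $ i $ j * v $ j * g $ i)" by (rule sum.swap)
    also have "\<dots> = (\<Sum>j\<in>UNIV. v $ j * (transpose A *v g) $ j)"
      by (simp add: matrix_vector_mult_def transpose_def sum_distrib_left mult_ac)
    finally show ?thesis unfolding g(2) by simp
  qed
  define f where "f = of_real (1 / norm f0) *s f0"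
  have "norm f = 1" using f0 by (simp add: f_def norm_vec_scale norm_divide)
  then have "cinner f f = 1" by (simp add: cinner_self)
  moreover have "cinner (A *v v) f = 0" for v by (simp add: f_def cinner_linear perp)
  ultimately have "defect_one A e f" using ee Ae form by unfold_locales auto
  then show ?thesis by blast
qed

context defect_one
begin

lemma norm_A_squared: "(norm (A *v x))\<^sup>2 = (norm x)\<^sup>2 - (cmod (cinner x e))\<^sup>2"
proof -
  have "complex_of_real ((norm (A *v x))\<^sup>2) = of_real ((norm x)\<^sup>2) - of_real ((cmod (cinner x e))\<^sup>2)"
    unfolding cinner_self[symmetric] complex_norm_square cnj_cinner by (rule defect)
  also have "\<dots> = of_real ((norm x)\<^sup>2 - (cmod (cinner x e))\<^sup>2)" by simp
  finally show ?thesis by (simp only: of_real_eq_iff)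
qed

lemma norm_A_le: "norm (A *v x) \<le> norm x"
proof (rule power2_le_imp_le)
  show "(norm (A *v x))\<^sup>2 \<le> (norm x)\<^sup>2" unfolding norm_A_squared by simp
qed simp

lemma norm_A_plus_f_squared:
  "(norm (A *v x + k *s f))\<^sup>2 = (norm (A *v x))\<^sup>2 + (cmod k)\<^sup>2"
proof -
  have "cinner f (A *v x) = 0" using range_perp_f[of x] cnj_cinner[of "A *v x" f] by simp
  then have "complex_of_real ((norm (A *v x + k *s f))\<^sup>2) = of_real ((norm (A *v x))\<^sup>2) + of_real ((cmod k)\<^sup>2)"
    unfolding cinner_self[symmetric] complex_norm_square
    by (simp add: cinner_linear range_perp_f cinner_f)
  also have "\<dots> = of_real ((norm (A *v x))\<^sup>2 + (cmod k)\<^sup>2)" by simp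
  finally show ?thesis by (simp only: of_real_eq_iff)
qed

section \<open>Unimodular eigenvalues\<close>

lemma norm_e: "norm e = 1"
proof -
  have "complex_of_real ((norm e)\<^sup>2) = 1" using cinner_e by (simp only: cinner_self)
  then have "(norm e)\<^sup>2 = 1" by (simp only: of_real_eq_1_iff)
  then show ?thesis by (metis norm_ge_zero power2_eq_imp_eq one_power2 zero_le_one)
qed

lemma numerical_radius_le_1:
  assumes "p \<in> numerical_range A"
  shows "cmod p \<le> 1"
proof -
  obtain y where "norm y = 1" "p = cinner (A *v y) y" using assms by (auto simp: numerical_range_def)
  then show ?thesis using cmod_cinner_le[of "A *v y" y] norm_A_le[of y] by simp
qed

text \<open>Since \<open>A\<close> is a contraction, a unimodular value of the quadratic form is a case of equality in the Cauchy-Schwarz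
inequality.\<close>

lemma eigenvector_if_numerical_value:
  assumes "norm y = 1" "cmod \<zeta> = 1" "cinner (A *v y) y = \<zeta>"
  shows "A *v y = \<zeta> *s y"
proof -
  let ?d = "A *v y - \<zeta> *s y"
  have sq: "\<zeta> * cnj \<zeta> = 1" using assms(2) complex_norm_square[of \<zeta>] by simp
  have "cinner y (A *v y) = cnj \<zeta>" using assms(3) cnj_cinner by metis
  then have "cinner ?d ?d = cinner (A *v y) (A *v y) - 2 * (\<zeta> * cnj \<zeta>) + (\<zeta> * cnj \<zeta>) * cinner y y"
    by (simp add: cinner_linear assms(3) algebra_simps)
  also have "\<dots> = of_real ((norm (A *v y))\<^sup>2 - 1)"
    unfolding sq cinner_self using assms(1) by simp
  finally have "(norm ?d)\<^sup>2 = (norm (A *v y))\<^sup>2 - 1" unfolding cinner_self by (simp only: of_real_eq_iff)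
  moreover have "(norm (A *v y))\<^sup>2 \<le> 1"
    using norm_A_le[of y] assms(1) by (simp add: power_le_one)
  ultimately have "(norm ?d)\<^sup>2 \<le> 0" by simp
  then show ?thesis by simp
qed

text \<open>An eigenvector on which \<open>A\<close> is isometric is orthogonal to \<open>e\<close>, and on the complement of \<open>e\<close> the map \<open>A\<close>
preserves inner products.\<close>

lemma unimodular_eigenvector_reduces:
  assumes "cmod \<zeta> = 1" "A *v x = \<zeta> *s x" "cinner v x = 0"
  shows "cinner (A *v v) x = 0"
proof -
  have "(cmod (cinner x e))\<^sup>2 = 0"
    using norm_A_squared[of x] by (simp add: assms norm_vec_scale)
  then have "cinner e x = 0" using cnj_cinner[of x e] by simp
  then have "cinner (A *v v) (\<zeta> *s x) = 0"
    using defect[of v x] by (simp add: assms)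
  then show ?thesis using assms(1) by (auto simp: cinner_linear)
qed

text \<open>If \<open>x\<close> is an eigenvector for \<open>\<zeta>\<close>, the value at \<open>y\<close> is a convex combination of \<open>\<zeta>\<close> and a point of the disk.
Here it is the boundary point in a direction other than \<open>\<zeta>\<close>, an extreme point of the disk, and the weight of \<open>\<zeta>\<close>,
which is the square of \<open>\<bar>\<langle>y, x\<rangle>\<bar>\<close>, has to be zero.\<close>

lemma support_vector_orthogonal:
  assumes W: "numerical_range A = cball c r" and r: "0 < r"
    and \<zeta>: "cmod \<zeta> = 1" "\<zeta> = c + of_real r * \<zeta>"
    and \<omega>: "cmod \<omega> = 1" "\<omega> \<noteq> \<zeta>"
    and y: "norm y = 1" "cinner (A *v y) y = c + of_real r * \<omega>"
    and x: "norm x = 1" "A *v x = \<zeta> *s x"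
  shows "cinner y x = 0"
proof -
  define s v where "s = cinner y x" and "v = y - s *s x"
  have xx: "cinner x x = 1" using x(1) by (simp add: cinner_self)
  have vx: "cinner v x = 0" by (simp add: v_def cinner_linear xx s_def)
  have xv: "cinner x v = 0" using vx cnj_cinner[of v x] by simp
  have Avx: "cinner (A *v v) x = 0" by (rule unimodular_eigenvector_reduces[OF \<zeta>(1) x(2) vx])
  have ysum: "y = s *s x + v" by (simp add: v_def)
  have "cinner y y = s * cnj s + cinner v v"
    unfolding ysum by (simp add: cinner_linear xx vx xv)
  then have "of_real 1 = complex_of_real ((cmod s)\<^sup>2 + (norm v)\<^sup>2)"
    unfolding cinner_self complex_norm_square[symmetric] by (simp add: y(1))
  then have norms: "(norm v)\<^sup>2 = 1 - (cmod s)\<^sup>2" by (simp only: of_real_eq_iff)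
  have form: "cinner (A *v y) y = of_real ((cmod s)\<^sup>2) * \<zeta> + cinner (A *v v) v"
    unfolding ysum complex_norm_square
    by (simp add: vec.add vec.scale x(2) cinner_linear xx xv Avx algebra_simps)
  define h where "h = Re (cnj \<omega> * c) + r"
  have \<omega>\<omega>: "\<omega> * cnj \<omega> = 1" using \<omega>(1) complex_norm_square[of \<omega>] by simp
  have "cnj \<omega> * (c + of_real r * \<omega>) = cnj \<omega> * c + of_real r * (\<omega> * cnj \<omega>)"
    by (simp add: algebra_simps)
  then have top: "Re (cnj \<omega> * cinner (A *v y) y) = h" by (simp only: y(2) \<omega>\<omega> h_def) simp
  have Re_scale: "Re (of_real t * u) = t * Re u" for t u by simp
  have v: "Re (cnj \<omega> * cinner (A *v v) v) \<le> h * (norm v)\<^sup>2"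
  proof (cases "v = 0")
    case False
    let ?q = "cinner (A *v v) v / of_real ((norm v)\<^sup>2)"
    have "?q \<in> cball c r" using scaled_quotient_in_numerical_range[OF False, of A] W by simp
    from disk_half_plane[OF \<omega>(1) this]
    have "(norm v)\<^sup>2 * Re (cnj \<omega> * ?q) \<le> (norm v)\<^sup>2 * h"
      unfolding h_def by (rule mult_left_mono) simp
    moreover have "cnj \<omega> * cinner (A *v v) v = of_real ((norm v)\<^sup>2) * (cnj \<omega> * ?q)"
      using False by simp
    ultimately show ?thesis by (simp only: Re_scale mult.commute)
  qed simp
  have "cnj \<omega> * cinner (A *v y) y = of_real ((cmod s)\<^sup>2) * (cnj \<omega> * \<zeta>) + cnj \<omega> * cinner (A *v v) v"
    unfolding form by (simp add: algebra_simps)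
  then have "h = (cmod s)\<^sup>2 * Re (cnj \<omega> * \<zeta>) + Re (cnj \<omega> * cinner (A *v v) v)"
    unfolding top[symmetric] by (simp add: algebra_simps)
  also have "\<dots> \<le> (cmod s)\<^sup>2 * Re (cnj \<omega> * \<zeta>) + h * (1 - (cmod s)\<^sup>2)"
    using v by (simp add: norms)
  finally have le: "(cmod s)\<^sup>2 * (h - Re (cnj \<omega> * \<zeta>)) \<le> 0" by (simp add: algebra_simps)
  have "cnj \<omega> * \<zeta> = cnj \<omega> * (c + of_real r * \<zeta>)"
    using \<zeta>(2) by (rule arg_cong)
  also have "\<dots> = cnj \<omega> * c + of_real r * (cnj \<omega> * \<zeta>)" by (simp add: algebra_simps)
  finally have "Re (cnj \<omega> * \<zeta>) = Re (cnj \<omega> * c + of_real r * (cnj \<omega> * \<zeta>))"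
    by (rule arg_cong)
  then have "Re (cnj \<omega> * \<zeta>) = Re (cnj \<omega> * c) + r * Re (cnj \<omega> * \<zeta>)"
    by (simp only: plus_complex.sel Re_scale)
  moreover have "Re (cnj \<omega> * \<zeta>) < 1"
    using unimodular_eqI[OF \<omega>(1) \<zeta>(1)] \<omega>(2) by (meson not_le)
  then have "r * Re (cnj \<omega> * \<zeta>) < r * 1" using r by (rule mult_strict_left_mono)
  ultimately have "h - Re (cnj \<omega> * \<zeta>) > 0" by (simp add: h_def)
  with le have "(cmod s)\<^sup>2 \<le> 0" by (simp add: mult_le_0_iff)
  then show ?thesis by (simp add: s_def)
qed

text \<open>The disk lies in the unit disk and contains \<open>\<zeta>\<close>, so it is tangent to the unit circle at \<open>\<zeta>\<close>. Unit vectors \<open>Y k\<close>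
that represent boundary points converging to \<open>\<zeta>\<close> are orthogonal to all eigenvectors for \<open>\<zeta>\<close>. By
compactness they accumulate at a unit vector \<open>y\<close> representing \<open>\<zeta>\<close>, which is itself an eigenvector
and thus orthogonal to itself.\<close>

lemma no_unimodular_eigenvalue_if_disk:
  assumes W: "numerical_range A = cball c r" and r: "0 \<le> r" and c: "c \<noteq> 0"
    and \<zeta>: "cmod \<zeta> = 1" and x: "A *v x = \<zeta> *s x"
  shows "x = 0"
proof (rule ccontr)
  assume x0: "x \<noteq> 0"
  have "0 \<in> cball c r"
    unfolding W[symmetric] numerical_range_def using A_e norm_e by (auto intro!: exI[of _ e])
  \<comment> \<open>The vector \<open>e\<close> puts \<open>0\<close> into the numerical range, which excludes a one-point disk away from \<open>0\<close>.\<close>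
  then have rpos: "r > 0" using c r by (cases "r = 0") auto
  have "cinner (A *v x) x / of_real ((norm x)\<^sup>2) = \<zeta>"
    using x0 by (simp add: x cinner_linear cinner_self)
  then have \<zeta>W: "\<zeta> \<in> cball c r" using scaled_quotient_in_numerical_range[OF x0, of A] W by simp
  \<comment> \<open>The point of the disk farthest from the origin is \<open>c + r sgn c\<close>.\<close>
  have cr: "cmod c + r \<le> 1"
  proof -
    have "c + of_real r * sgn c \<in> numerical_range A"
      unfolding W using c r by (simp add: dist_norm norm_mult norm_sgn)
    then have "cmod (c + of_real r * sgn c) \<le> 1" by (rule numerical_radius_le_1)
    also have "c + of_real r * sgn c = of_real (cmod c + r) * sgn c"
      using c by (simp add: sgn_eq algebra_simps)
    also have "cmod \<dots> = cmod c + r" using c r by (simp add: norm_mult norm_sgn flip: of_real_add)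
    finally show ?thesis .
  qed
  have \<zeta>\<zeta>: "cnj \<zeta> * \<zeta> = 1" using \<zeta> complex_norm_square[of \<zeta>] by (simp add: mult.commute)
  have "Re (cnj \<zeta> * c) \<le> cmod (cnj \<zeta> * c)" by (rule complex_Re_le_cmod)
  also have "\<dots> = cmod c" by (simp add: norm_mult \<zeta>)
  finally have "r \<le> Re (cnj \<zeta> * \<zeta>) - Re (cnj \<zeta> * c)" using cr unfolding \<zeta>\<zeta> by simp
  then have \<zeta>_top: "\<zeta> = c + of_real r * \<zeta>"
    by (intro disk_support_point[OF \<zeta> \<zeta>W r]) (simp only: right_diff_distrib minus_complex.sel)
  define w where "w k = \<zeta> * cis (1 / (real k + 1))" for k :: nat
  have w1: "cmod (w k) = 1" for k using \<zeta> by (simp add: w_def norm_mult)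
  have w\<zeta>: "w k \<noteq> \<zeta>" for k unfolding w_def by (rule rotation_ne[OF \<zeta>])
  have wlim: "w \<longlonglongrightarrow> \<zeta>" unfolding w_def[abs_def] by (rule rotation_tendsto)
  have "\<exists>y. norm y = 1 \<and> cinner (A *v y) y = c + of_real r * w k" for k
  proof -
    have "c + of_real r * w k \<in> numerical_range A" unfolding W using w1[of k] r by (simp add: dist_norm norm_mult)
    then show ?thesis by (auto simp: numerical_range_def)
  qed
  then obtain Y where Y: "\<And>k. norm (Y k) = 1" "\<And>k. cinner (A *v Y k) (Y k) = c + of_real r * w k" by metis
  have "seq_compact (sphere (0 :: complex ^ 'n) 1)" by (intro compact_imp_seq_compact compact_sphere)
  moreover have "\<forall>k. Y k \<in> sphere 0 1" using Y(1) by simp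
  ultimately obtain y \<phi> where y: "y \<in> sphere 0 1" and \<phi>: "strict_mono \<phi>" "(Y \<circ> \<phi>) \<longlonglongrightarrow> y"
    unfolding seq_compact_def by metis
  have ylim: "(\<lambda>k. Y (\<phi> k)) \<longlonglongrightarrow> y" using \<phi>(2) by (simp add: o_def)
  have ny: "norm y = 1" using y by simp
  have "(\<lambda>k. cinner (A *v Y (\<phi> k)) (Y (\<phi> k))) \<longlonglongrightarrow> cinner (A *v y) y"
    by (intro tendsto_cinner ylim tendsto_matrix_vector_mult)
  moreover have "(\<lambda>k. c + of_real r * w (\<phi> k)) \<longlonglongrightarrow> c + of_real r * \<zeta>"
    using LIMSEQ_subseq_LIMSEQ[OF wlim \<phi>(1)] by (intro tendsto_intros) (simp add: o_def)
  ultimately have "cinner (A *v y) y = \<zeta>"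
    unfolding Y(2) \<zeta>_top[symmetric] by (rule LIMSEQ_unique)
  then have "A *v y = \<zeta> *s y" by (rule eigenvector_if_numerical_value[OF ny \<zeta>])
  then have "cinner (Y k) y = 0" for k
    by (intro support_vector_orthogonal[OF W rpos \<zeta> \<zeta>_top w1 w\<zeta> Y ny])
  moreover have "(\<lambda>k. cinner (Y (\<phi> k)) y) \<longlonglongrightarrow> cinner y y"
    by (intro tendsto_cinner ylim tendsto_const)
  ultimately have "cinner y y = 0" by (simp add: LIMSEQ_const_iff)
  then show False using ny by (simp add: cinner_self)
qed

section \<open>Rank-one perturbations\<close>

abbreviation "a \<equiv> char_poly A"

text \<open>The function \<open>F\<close> is \<open>z a(z) / denom z\<close>. As the determinant is affine in a rank-one perturbation,
\<open>denom\<close> is the coefficient of \<open>-s\<close> in \<open>det (z - A - s f e\<^sup>*)\<close>.\<close>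

definition "denom = a - char_poly (A + outer_mat f e)"

text \<open>The vector \<open>(z - A)\<inverse> f\<close>, by Cramer's rule, from which its continuity in \<open>z\<close> can be read off.\<close>

definition resolvent_f where
  "resolvent_f z = (\<chi> k. det (\<chi> i j. if j = k then f $ i else (mat z - A) $ i $ j) / det (mat z - A))"

lemma resolvent_f:
  assumes "poly a z \<noteq> 0"
  shows "(mat z - A) *v resolvent_f z = f"
  using cramer[of "mat z - A" "resolvent_f z" f] assms by (simp add: poly_char_poly resolvent_f_def)

lemma A_resolvent_f:
  assumes "poly a z \<noteq> 0"
  shows "A *v resolvent_f z = z *s resolvent_f z - f"
proof -
  have "z *s resolvent_f z - A *v resolvent_f z = f"
    using resolvent_f[OF assms]
    by (simp only: matrix_vector_mult_diff_rdistrib scalar_matrix_vector_mult)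
  then show ?thesis by (metis diff_diff_eq2 add_diff_cancel_left')
qed

lemma a_nonzero: "a \<noteq> 0"
  using lead_coeff_char_poly[of A] by auto

lemma det_rank_one_perturbation:
  assumes "(mat z - A) *v y = f"
  shows "poly (char_poly (A + outer_mat (s *s f) e)) z = poly a z * (1 - s * cinner y e)"
proof -
  \<comment> \<open>Since \<open>f\<close> is in the range of \<open>z - A\<close>, this matrix splits off as a factor.\<close>
  have "mat z - (A + outer_mat (s *s f) e) = (mat z - A) ** (mat 1 - outer_mat (s *s y) e)"
  proof (rule matrix_eq[THEN iffD2], rule allI)
    fix v
    have "(mat z - A) *v (k *s y) = k *s f" for k
      using assms by (simp add: vec.scale)
    then have "(mat z - A) *v (outer_mat (s *s y) e *v v) = outer_mat (s *s f) e *v v"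
      by (simp add: outer_mat_mult_vec)
    then show "(mat z - (A + outer_mat (s *s f) e)) *v v = ((mat z - A) ** (mat 1 - outer_mat (s *s y) e)) *v v"
      by (simp only: matrix_vector_mul_assoc[symmetric] matrix_vector_mult_diff_rdistrib[of "mat 1"]
          matrix_vector_mul_lid matrix_vector_mult_diff_distrib)
        (simp only: matrix_vector_mult_diff_rdistrib matrix_vector_mult_add_rdistrib diff_diff_eq)
  qed
  then show ?thesis
    by (simp add: poly_char_poly det_mul det_mat_1_minus_outer cinner_linear)
qed

lemma poly_denom:
  assumes "poly a z \<noteq> 0"
  shows "poly denom z = poly a z * cinner (resolvent_f z) e"
proof -
  have "poly (char_poly (A + outer_mat f e)) z = poly a z * (1 - cinner (resolvent_f z) e)"
    using det_rank_one_perturbation[OF resolvent_f[OF assms], of 1] by simp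
  then show ?thesis unfolding denom_def poly_diff by (simp only: right_diff_distrib mult_1_right) simp
qed

text \<open>Both sides agree wherever \<open>z - A\<close> is invertible, that is, at all but finitely many \<open>z\<close>.\<close>

lemma char_poly_rank_one_perturbation: "char_poly (A + outer_mat (s *s f) e) = a - smult s denom"
proof (rule ccontr)
  let ?d = "char_poly (A + outer_mat (s *s f) e) - (a - smult s denom)"
  assume "\<not> ?thesis"
  then have "finite {z. poly ?d z = 0}" by (intro poly_roots_finite) auto
  moreover have "finite {z. poly a z = 0}" by (intro poly_roots_finite a_nonzero)
  ultimately have "finite ({z. poly ?d z = 0} \<union> {z. poly a z = 0})" by blast
  moreover have "{z. poly ?d z = 0} \<union> {z. poly a z = 0} = UNIV"
  proof (intro equalityI subsetI)
    fix z
    show "z \<in> {z. poly ?d z = 0} \<union> {z. poly a z = 0}"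
      using det_rank_one_perturbation[OF resolvent_f, of z s] poly_denom[of z]
      by (cases "poly a z = 0") (simp_all add: algebra_simps)
  qed simp
  ultimately show False
    using infinite_UNIV_char_0[where 'a = complex] by (simp only:)
qed

lemma degree_denom: "degree denom < CARD('n)"
proof -
  have le: "degree denom \<le> CARD('n)"
    unfolding denom_def by (intro degree_diff_le) (simp_all add: degree_char_poly)
  have c: "coeff denom (CARD('n)) = 0"
    using lead_coeff_char_poly[of A] lead_coeff_char_poly[of "A + outer_mat f e"]
    by (simp add: denom_def degree_char_poly)
  show ?thesis
  proof (cases "denom = 0")
    case False
    then have "coeff denom (degree denom) \<noteq> 0" by simp
    then have "degree denom \<noteq> CARD('n)" using c by fastforce
    then show ?thesis using le by simp
  qed simp
qed

lemma poly_a_0: "poly a 0 = 0"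
proof -
  have "e \<noteq> 0" using cinner_e by auto
  moreover have "(mat 0 - A) *v e = 0"
    by (simp only: matrix_vector_mult_diff_rdistrib scalar_matrix_vector_mult A_e) simp
  ultimately show ?thesis unfolding poly_char_poly det_eq_0_iff_kernel by blast
qed

lemma perturbed_norm:
  "(norm ((A + outer_mat (s *s f) e) *v x))\<^sup>2 = (norm x)\<^sup>2 - (cmod (cinner x e))\<^sup>2 + (cmod s * cmod (cinner x e))\<^sup>2"
proof -
  have "(A + outer_mat (s *s f) e) *v x = A *v x + (s * cinner x e) *s f"
    by (simp add: matrix_vector_mult_add_rdistrib outer_mat_mult_vec mult.commute)
  then show ?thesis by (simp add: norm_A_plus_f_squared norm_A_squared norm_mult)
qed

text \<open>As \<open>A\<close> is singular, the value is up to sign the determinant of \<open>A + f e\<^sup>*\<close>, which is unitary.\<close>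

lemma poly_denom_0: "poly denom 0 \<noteq> 0"
proof
  assume "poly denom 0 = 0"
  then have "det (mat 0 - (A + outer_mat (1 *s f) e)) = 0"
    unfolding poly_char_poly[symmetric] char_poly_rank_one_perturbation by (simp add: poly_a_0)
  then obtain x where x: "x \<noteq> 0" "(mat 0 - (A + outer_mat (1 *s f) e)) *v x = 0"
    unfolding det_eq_0_iff_kernel by blast
  then have "(A + outer_mat (1 *s f) e) *v x = 0"
    by (simp only: matrix_vector_mult_diff_rdistrib[of "mat 0"] scalar_matrix_vector_mult vec.scale_zero_left diff_0 neg_equal_0_iff_equal)
  then show False using perturbed_norm[of 1 x] x(1) by simp
qed

text \<open>A point \<open>z\<close> of the fibre over \<open>w\<close> is an eigenvalue of \<open>A + (w/z) f e\<^sup>*\<close>. For \<open>\<bar>z\<bar> < 1\<close> this perturbation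
does not decrease norms, and for \<open>\<bar>z\<bar> > 1\<close> it does not increase them, so neither is possible.\<close>

lemma fibre_unimodular:
  assumes w: "cmod w = 1" and z: "z * poly a z = w * poly denom z"
  shows "cmod z = 1"
proof -
  have z0: "z \<noteq> 0" using z w poly_denom_0 by auto
  then have "poly (char_poly (A + outer_mat ((w / z) *s f) e)) z = 0"
    unfolding char_poly_rank_one_perturbation using z by (simp add: eq_divide_eq mult.commute)
  then obtain x where x: "x \<noteq> 0" "(mat z - (A + outer_mat ((w / z) *s f) e)) *v x = 0"
    unfolding poly_char_poly det_eq_0_iff_kernel by blast
  then have "(A + outer_mat ((w / z) *s f) e) *v x = z *s x"
    by (simp only: matrix_vector_mult_diff_rdistrib[of "mat z"] scalar_matrix_vector_mult right_minus_eq)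
  then have eq: "(cmod z)\<^sup>2 * (norm x)\<^sup>2 =
      (norm x)\<^sup>2 - (cmod (cinner x e))\<^sup>2 + (cmod (cinner x e))\<^sup>2 / (cmod z)\<^sup>2"
    using perturbed_norm[of "w / z" x] w
    by (simp add: norm_vec_scale power_mult_distrib norm_divide power_divide)
  \<comment> \<open>The equation of norms is polynomial in \<open>t = \<bar>z\<bar>\<^sup>2\<close> and \<open>t - 1\<close> is its only factor with a positive root.\<close>
  define t N c where "t = (cmod z)\<^sup>2" and "N = (norm x)\<^sup>2" and "c = (cmod (cinner x e))\<^sup>2"
  have pos: "t > 0" "N > 0" "c \<ge> 0" using z0 x(1) by (auto simp: t_def N_def c_def)
  have "t * N = N - c + c / t" using eq by (simp add: t_def N_def c_def)
  then have "t * (t * N) = t * (N - c + c / t)" by (rule arg_cong)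
  also have "\<dots> = t * (N - c) + c" using pos by (simp add: distrib_left)
  finally have "(t - 1) * (t * N + c) = 0" by algebra
  moreover have "t * N + c > 0" using pos by (simp add: add_pos_nonneg)
  ultimately have "t = 1" by auto
  then show ?thesis using power2_eq_imp_eq[of "cmod z" 1] by (simp add: t_def)
qed

lemma tendsto_resolvent_f:
  assumes "(g \<longlongrightarrow> z) F" "poly a z \<noteq> 0"
  shows "((\<lambda>t. resolvent_f (g t)) \<longlongrightarrow> resolvent_f z) F"
proof (rule vec_tendstoI)
  fix k
  have M: "((\<lambda>t. (mat (g t) - A) $ i $ j) \<longlongrightarrow> (mat z - A) $ i $ j) F" for i j
    by (cases "i = j") (simp_all add: mat_def tendsto_diff assms(1))
  have "((\<lambda>t. det (\<chi> i j. if j = k then f $ i else (mat (g t) - A) $ i $ j)) \<longlongrightarrow>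
      det (\<chi> i j. if j = k then f $ i else (mat z - A) $ i $ j)) F"
    using M by (intro tendsto_det) auto
  moreover have "((\<lambda>t. det (mat (g t) - A)) \<longlongrightarrow> det (mat z - A)) F"
    using M by (intro tendsto_det) auto
  ultimately show "((\<lambda>t. resolvent_f (g t) $ k) \<longlongrightarrow> resolvent_f z $ k) F"
    using assms(2) by (simp add: resolvent_f_def poly_char_poly tendsto_divide)
qed

end

section \<open>The resolvent on the unit circle\<close>

locale defect_one_no_unimodular = defect_one A e f
  for A :: "complex ^ 'n ^ 'n" and e f +
  assumes no_unimodular: "cmod z = 1 \<Longrightarrow> A *v x = z *s x \<Longrightarrow> x = 0"
begin

lemma char_poly_nonzero_on_circle:
  assumes "cmod z = 1"
  shows "poly a z \<noteq> 0"
proof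
  assume "poly a z = 0"
  then obtain x where x: "x \<noteq> 0" "(mat z - A) *v x = 0"
    unfolding poly_char_poly det_eq_0_iff_kernel by blast
  then have "A *v x = z *s x"
    by (simp only: matrix_vector_mult_diff_rdistrib scalar_matrix_vector_mult right_minus_eq)
  with assms x(1) no_unimodular show False by blast
qed

lemma resolvent_cinner_f:
  assumes "cmod z = 1"
  shows "z * cinner (resolvent_f z) f = 1"
  using range_perp_f[of "resolvent_f z"]
  unfolding A_resolvent_f[OF char_poly_nonzero_on_circle[OF assms]]
  by (simp add: cinner_linear cinner_f)

text \<open>The inner product of \<open>A x\<^sub>\<alpha> = \<alpha> x\<^sub>\<alpha> - f\<close> and \<open>A x\<^sub>\<beta> = \<beta> x\<^sub>\<beta> - f\<close>, computed in two ways. It makes the vectors \<open>x\<^sub>z\<close>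
behave like the reproducing kernels of the space associated with \<open>F\<close>.\<close>

lemma resolvent_gram:
  assumes "cmod \<alpha> = 1" "cmod \<beta> = 1"
  shows "(1 - \<alpha> * cnj \<beta>) * cinner (resolvent_f \<alpha>) (resolvent_f \<beta>) =
    cinner (resolvent_f \<alpha>) e * cinner e (resolvent_f \<beta>) - 1"
proof -
  let ?x = "resolvent_f \<alpha>" and ?y = "resolvent_f \<beta>"
  have fx: "\<alpha> * cinner ?x f = 1" by (rule resolvent_cinner_f) fact
  have "cnj (\<beta> * cinner ?y f) = 1" using resolvent_cinner_f[OF assms(2)] by simp
  then have fy: "cnj \<beta> * cinner f ?y = 1" by (simp add: cnj_cinner)
  have "cinner ?x ?y - cinner ?x e * cinner e ?y = cinner (\<alpha> *s ?x - f) (\<beta> *s ?y - f)"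
    unfolding defect[symmetric] using assms by (simp add: A_resolvent_f char_poly_nonzero_on_circle)
  also have "\<dots> = \<alpha> * cnj \<beta> * cinner ?x ?y - \<alpha> * cinner ?x f - (cnj \<beta> * cinner f ?y - 1)"
    by (simp add: cinner_linear cinner_f algebra_simps)
  also have "\<dots> = \<alpha> * cnj \<beta> * cinner ?x ?y - 1" by (simp add: fx fy)
  finally show ?thesis by (simp add: algebra_simps)
qed

text \<open>That is, \<open>\<bar>F\<bar> = 1\<close> on the unit circle.\<close>

lemma cmod_resolvent_cinner_e:
  assumes "cmod z = 1"
  shows "cinner (resolvent_f z) e * cinner e (resolvent_f z) = 1"
  using resolvent_gram[OF assms assms] unimodular_mult_cnj[OF assms] by simp

lemma denom_nonzero_on_circle:
  assumes "cmod z = 1"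
  shows "poly denom z \<noteq> 0"
  using cmod_resolvent_cinner_e[OF assms] char_poly_nonzero_on_circle[OF assms]
  by (auto simp: poly_denom)

text \<open>The squared norm of the vector \<open>(x\<^sub>z, 1)\<close>, an eigenvector of the unitary dilation of \<open>A\<close> up to a unimodular factor
in its first component.\<close>

definition weight :: "complex \<Rightarrow> real" where
  "weight z = 1 + (norm (resolvent_f z))\<^sup>2"

lemma weight_pos: "weight z > 0"
  by (simp add: weight_def add_pos_nonneg)

text \<open>The denominator-free form of \<open>u = 1 + z (a'/a - denom'/denom) = z F'/F\<close>, the limit of \<open>resolvent_gram\<close> as
\<open>\<beta>\<close> tends to \<open>\<alpha>\<close> along the circle. Conjugates are eliminated by \<open>cnj \<beta> = 1/\<beta>\<close> and \<open>\<bar>g\<bar> = 1\<close> for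
\<open>g = denom / a\<close>, and what remains is a difference quotient of \<open>g\<close>.\<close>

lemma weight_eq:
  assumes z: "cmod z = 1"
  shows "of_real (weight z) * poly a z * poly denom z =
    poly a z * poly denom z + z * (poly (pderiv a) z * poly denom z - poly a z * poly (pderiv denom) z)"
proof -
  define g where "g y = poly denom y / poly a y" for y
  have a0: "poly a z \<noteq> 0" and Q0: "poly denom z \<noteq> 0"
    using z by (simp_all add: char_poly_nonzero_on_circle denom_nonzero_on_circle)
  have g: "g y = cinner (resolvent_f y) e" if "cmod y = 1" for y
    using poly_denom[of y] char_poly_nonzero_on_circle[OF that] by (simp add: g_def)
  define D where "D = (poly (pderiv denom) z * poly a z - poly denom z * poly (pderiv a) z) / (poly a z * poly a z)"
  have deriv: "(g has_field_derivative D) (at z)"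
    unfolding g_def D_def using a0 by (auto intro!: derivative_eq_intros)
  define b where "b k = z * cis (1 / (real k + 1))" for k :: nat
  have b1: "cmod (b k) = 1" for k using z by (simp add: b_def norm_mult)
  have bz: "b k \<noteq> z" for k unfolding b_def by (rule rotation_ne[OF z])
  have blim: "b \<longlonglongrightarrow> z" unfolding b_def[abs_def] by (rule rotation_tendsto)
  have quot: "(\<lambda>k. (g (b k) - g z) / (b k - z)) \<longlonglongrightarrow> D"
  proof (rule filterlim_compose[of "\<lambda>y. (g y - g z) / (y - z)"])
    show "(\<lambda>y. (g y - g z) / (y - z)) \<midarrow>z\<rightarrow> D"
      using deriv by (simp only: has_field_derivative_iff)
    show "filterlim b (at z) sequentially"
      unfolding filterlim_at using blim bz by simp
  qed
  have gram: "cinner (resolvent_f z) (resolvent_f (b k)) = - (b k / g (b k)) * ((g (b k) - g z) / (b k - z))" for k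
  proof -
    have bb: "b k * cnj (b k) = 1" by (rule unimodular_mult_cnj[OF b1])
    have "g (b k) * cinner e (resolvent_f (b k)) = 1"
      using cmod_resolvent_cinner_e[OF b1] by (simp add: g b1)
    moreover have gb: "g (b k) \<noteq> 0" using calculation by auto
    ultimately have ge: "cinner e (resolvent_f (b k)) = 1 / g (b k)" by (simp add: field_simps)
    have "b k * g (b k) * ((1 - z * cnj (b k)) * cinner (resolvent_f z) (resolvent_f (b k))) =
        b k * g (b k) * (g z * (1 / g (b k)) - 1)"
      using resolvent_gram[OF z b1[of k]] by (simp add: g z ge)
    also have "\<dots> = b k * (g z - g (b k))" using gb by (simp add: field_simps)
    finally have "g (b k) * (b k - z * (b k * cnj (b k))) * cinner (resolvent_f z) (resolvent_f (b k)) = b k * (g z - g (b k))"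
      by (simp add: algebra_simps)
    then have "g (b k) * (b k - z) * cinner (resolvent_f z) (resolvent_f (b k)) = b k * (g z - g (b k))"
      by (simp add: bb)
    then show ?thesis using gb bz[of k] by (simp add: field_simps)
  qed
  have "g z \<noteq> 0" using Q0 a0 by (simp add: g_def)
  have "g \<midarrow>z\<rightarrow> g z" using DERIV_isCont[OF deriv] by (simp add: isCont_def)
  then have "(\<lambda>k. g (b k)) \<longlonglongrightarrow> g z"
    using DERIV_isCont[OF deriv] blim isCont_tendsto_compose by blast
  then have "(\<lambda>k. - (b k / g (b k)) * ((g (b k) - g z) / (b k - z))) \<longlonglongrightarrow> - (z / g z) * D"
    by (intro tendsto_intros blim quot \<open>g z \<noteq> 0\<close>)
  moreover have "(\<lambda>k. cinner (resolvent_f z) (resolvent_f (b k))) \<longlonglongrightarrow> cinner (resolvent_f z) (resolvent_f z)"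
    by (intro tendsto_cinner tendsto_const tendsto_resolvent_f blim a0)
  ultimately have "cinner (resolvent_f z) (resolvent_f z) = - (z / g z) * D"
    unfolding gram by (rule LIMSEQ_unique[rotated])
  then have "of_real (weight z) = 1 - z * (D / g z)"
    unfolding cinner_self by (simp add: weight_def)
  moreover have "D / g z * (poly a z * poly denom z) =
      poly (pderiv denom) z * poly a z - poly denom z * poly (pderiv a) z"
    using a0 Q0 by (simp add: D_def g_def)
  ultimately show ?thesis by algebra
qed

section \<open>Fibres and Poncelet polygons\<close>

definition numer where "numer = pCons 0 a"

definition fibre where "fibre w = {z. poly (numer - smult w denom) z = 0}"

lemma fibre_iff: "z \<in> fibre w \<longleftrightarrow> z * poly a z = w * poly denom z"
  by (simp add: fibre_def numer_def)

lemma degree_numer: "degree numer = Suc CARD('n)"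
  by (simp add: numer_def degree_char_poly a_nonzero)

lemma lead_coeff_numer: "lead_coeff numer = 1"
  using lead_coeff_char_poly[of A] by (simp add: numer_def a_nonzero)

lemma degree_pencil: "degree (numer - smult w denom) = Suc CARD('n)"
proof -
  have "degree (- smult w denom) < degree numer"
    using degree_denom degree_smult_le[of w denom] by (simp add: degree_numer)
  from degree_add_eq_left[OF this] show ?thesis by (simp add: degree_numer)
qed

context
  fixes w :: complex
  assumes w: "cmod w = 1"
begin

lemma norm_fibre: "z \<in> fibre w \<Longrightarrow> cmod z = 1"
  using fibre_unimodular[OF w] by (simp add: fibre_iff)

lemma resolvent_cinner_e_fibre:
  assumes "z \<in> fibre w"
  shows "w * cinner (resolvent_f z) e = z"
proof -
  have "poly a z \<noteq> 0" by (intro char_poly_nonzero_on_circle norm_fibre assms)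
  then show ?thesis using assms poly_denom[of z] by (simp add: fibre_iff)
qed

text \<open>The vectors \<open>(x\<^sub>z, 1)\<close> over the points of a fibre are orthogonal, as eigenvectors of a unitary matrix for different
eigenvalues. Without the last coordinate this becomes \<open>\<langle>x\<^sub>z, x\<^sub>y\<rangle> = -1\<close>.\<close>

lemma gram_fibre:
  assumes z: "z \<in> fibre w" and y: "y \<in> fibre w"
  shows "cinner (resolvent_f z) (resolvent_f y) = (if z = y then of_real (weight z) else 0) - 1"
proof (cases "z = y")
  case True
  then show ?thesis by (simp add: weight_def cinner_self)
next
  case False
  let ?s = "cinner (resolvent_f z) e" and ?t = "cinner e (resolvent_f y)"
  have "w * ?s * cnj (w * cinner (resolvent_f y) e) = z * cnj y"
    by (simp only: resolvent_cinner_e_fibre z y)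
  then have "(w * cnj w) * (?s * ?t) = z * cnj y" by (simp add: cnj_cinner mult_ac)
  then have st: "?s * ?t = z * cnj y" by (simp add: unimodular_mult_cnj[OF w])
  have "(1 - z * cnj y) * cinner (resolvent_f z) (resolvent_f y) = - (1 - z * cnj y)"
    using resolvent_gram[OF norm_fibre[OF z] norm_fibre[OF y]] st by simp
  moreover have "1 - z * cnj y \<noteq> 0"
  proof
    assume "1 - z * cnj y = 0"
    then have "y = z * (y * cnj y)" by (simp add: algebra_simps)
    with False show False by (simp add: unimodular_mult_cnj[OF norm_fibre[OF y]])
  qed
  ultimately have "cinner (resolvent_f z) (resolvent_f y) = - 1"
    by (metis mult_cancel_left mult_minus1_right)
  with False show ?thesis by simp
qed

text \<open>By \<open>weight_eq\<close>, the derivative at a root is \<open>u(z) a(z)\<close>.\<close>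

lemma fibre_simple:
  assumes z: "z \<in> fibre w"
  shows "poly (pderiv (numer - smult w denom)) z \<noteq> 0"
proof -
  have z1: "cmod z = 1" by (rule norm_fibre[OF z])
  have eq: "z * poly a z = w * poly denom z" using z by (simp add: fibre_iff)
  have "poly (pderiv (numer - smult w denom)) z * poly denom z =
      poly a z * poly denom z + z * poly (pderiv a) z * poly denom z - (w * poly denom z) * poly (pderiv denom) z"
    by (simp add: numer_def pderiv_diff pderiv_pCons pderiv_smult algebra_simps)
  also have "\<dots> = of_real (weight z) * poly a z * poly denom z"
    unfolding weight_eq[OF z1] eq[symmetric] by (simp add: algebra_simps)
  also have "\<dots> \<noteq> 0"
    using weight_pos[of z] z1 by (simp add: char_poly_nonzero_on_circle denom_nonzero_on_circle)
  finally show ?thesis by auto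
qed

lemma pencil_nonzero: "numer - smult w denom \<noteq> 0"
  using degree_pencil[of w] by auto

lemma finite_fibre: "finite (fibre w)"
  unfolding fibre_def by (rule poly_roots_finite[OF pencil_nonzero])

lemma card_fibre: "card (fibre w) = Suc CARD('n)"
  unfolding fibre_def degree_pencil[of w, symmetric]
  by (rule card_roots_eq_degree[OF pencil_nonzero]) (use fibre_simple in \<open>simp add: fibre_def\<close>)

text \<open>Combinations of the \<open>x\<^sub>z\<close> are used with coefficients of sum zero: these are the vectors of the dilation space
with last coordinate zero. There \<open>A\<close> is the first component of the unitary dilation, which multiplies the
coefficient at \<open>z\<close> by \<open>z\<close>.\<close>

definition combine where "combine c = (\<Sum>z\<in>fibre w. c z *s resolvent_f z)"

lemma cinner_combine:
  assumes "(\<Sum>z\<in>fibre w. d z) = 0"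
  shows "cinner (combine c) (combine d) = (\<Sum>z\<in>fibre w. c z * cnj (d z) * of_real (weight z))"
proof -
  have "cinner (combine c) (combine d) =
      (\<Sum>z\<in>fibre w. \<Sum>y\<in>fibre w. c z * cnj (d y) * cinner (resolvent_f z) (resolvent_f y))"
    unfolding combine_def cinner_sum_left cinner_sum_right
    by (subst sum.swap) (simp add: cinner_linear mult_ac)
  also have "\<dots> = (\<Sum>z\<in>fibre w. \<Sum>y\<in>fibre w. (if z = y then c z * cnj (d z) * of_real (weight z) else 0) - c z * cnj (d y))"
    by (intro sum.cong refl) (auto simp: gram_fibre algebra_simps)
  also have "\<dots> = (\<Sum>z\<in>fibre w. c z * cnj (d z) * of_real (weight z)) - (\<Sum>z\<in>fibre w. c z) * cnj (\<Sum>y\<in>fibre w. d y)"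
    by (simp add: sum_subtractf finite_fibre sum_product)
  finally show ?thesis by (simp add: assms)
qed

lemma A_combine:
  assumes "(\<Sum>z\<in>fibre w. c z) = 0"
  shows "A *v combine c = combine (\<lambda>z. z * c z)"
proof -
  have "A *v combine c = (\<Sum>z\<in>fibre w. c z *s (A *v resolvent_f z))"
    by (simp add: combine_def vec.sum vec.scale)
  also have "\<dots> = (\<Sum>z\<in>fibre w. (z * c z) *s resolvent_f z - c z *s f)"
    by (intro sum.cong refl)
       (simp add: A_resolvent_f char_poly_nonzero_on_circle norm_fibre vec.scale_right_diff_distrib mult.commute)
  also have "\<dots> = combine (\<lambda>z. z * c z) - (\<Sum>z\<in>fibre w. c z) *s f"
    by (simp add: combine_def sum_subtractf vec.scale_sum_left)
  finally show ?thesis by (simp add: assms)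
qed

text \<open>The differences of \<open>n\<close> of the vectors \<open>x\<^sub>z\<close> with the remaining one are linearly independent, by
\<open>cinner_combine\<close> and the positivity of the weights, so they form a basis.\<close>

lemma combine_exists: "\<exists>c. (\<Sum>z\<in>fibre w. c z) = 0 \<and> combine c = y"
proof -
  have "fibre w \<noteq> {}" using card_fibre by force
  then obtain p where p: "p \<in> fibre w" by blast
  define b where "b z = resolvent_f z - resolvent_f p" for z
  define F where "F = fibre w - {p}"
  have F: "finite F" "card F = CARD('n)" "fibre w = insert p F" "p \<notin> F"
    using finite_fibre card_fibre p by (auto simp: F_def)
  \<comment> \<open>The coefficient at \<open>p\<close> that makes the sum zero.\<close>
  define ext where "ext d z = (if z = p then - sum d F else d z)" for d :: "complex \<Rightarrow> complex" and z
  have ext_sum: "(\<Sum>z\<in>fibre w. ext d z) = 0" for d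
  proof -
    have "(\<Sum>z\<in>F. ext d z) = sum d F" using F(4) by (intro sum.cong) (auto simp: ext_def)
    then show ?thesis using F by (simp add: ext_def)
  qed
  have ext_combine: "combine (ext d) = (\<Sum>z\<in>F. d z *s b z)" for d
  proof -
    have "(\<Sum>z\<in>F. ext d z *s resolvent_f z) = (\<Sum>z\<in>F. d z *s resolvent_f z)"
      using F(4) by (intro sum.cong) (auto simp: ext_def)
    then have "combine (ext d) = - sum d F *s resolvent_f p + (\<Sum>z\<in>F. d z *s resolvent_f z)"
      using F by (simp add: combine_def ext_def)
    then show ?thesis
      by (simp add: b_def vec.scale_right_diff_distrib sum_subtractf vec.scale_sum_left)
  qed
  have ext_0: "d z = 0" if "combine (ext d) = 0" "z \<in> F" for d z
  proof -
    have "(\<Sum>z\<in>fibre w. ext d z * cnj (ext d z) * of_real (weight z)) = 0"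
      using cinner_combine[OF ext_sum, of "ext d" d] that(1) by simp
    also have "(\<Sum>z\<in>fibre w. ext d z * cnj (ext d z) * of_real (weight z)) =
        of_real (\<Sum>z\<in>fibre w. (cmod (ext d z))\<^sup>2 * weight z)"
      unfolding complex_norm_square[symmetric] by simp
    finally have "(\<Sum>z\<in>fibre w. (cmod (ext d z))\<^sup>2 * weight z) = 0" by (simp only: of_real_eq_0_iff)
    then have "(cmod (ext d z))\<^sup>2 * weight z = 0"
      using that(2) F(3) finite_fibre weight_pos
      by (subst (asm) sum_nonneg_eq_0_iff) (auto intro!: mult_nonneg_nonneg intro: less_imp_le)
    then show ?thesis using weight_pos[of z] that(2) F(4) by (auto simp: ext_def split: if_splits)
  qed
  have inj: "inj_on b F"
  proof (rule inj_onI)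
    fix z y assume zy: "z \<in> F" "y \<in> F" "b z = b y"
    show "z = y"
    proof (rule ccontr)
      assume "z \<noteq> y"
      define d where "d v = (if v = z then 1 else if v = y then - 1 else 0 :: complex)" for v
      have "(\<Sum>v\<in>F. d v *s b v) = (\<Sum>v\<in>{z, y}. d v *s b v)"
        using zy F(1) by (intro sum.mono_neutral_right) (auto simp: d_def)
      also have "\<dots> = 0" using \<open>z \<noteq> y\<close> zy(3) by (simp add: d_def)
      finally have "d z = 0" using ext_0[of d z] zy(1) by (simp add: ext_combine)
      then show False by (simp add: d_def)
    qed
  qed
  have "vec.independent (b ` F)"
  proof -
    have "u v = 0" if "(\<Sum>v\<in>b ` F. u v *s v) = 0" "v \<in> b ` F" for u v
    proof -
      have "(\<Sum>z\<in>F. (u \<circ> b) z *s b z) = 0" using that(1) by (simp add: sum.reindex[OF inj])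
      then show ?thesis using ext_0[of "u \<circ> b"] that(2) by (auto simp: ext_combine)
    qed
    then show ?thesis using F(1) by (subst vec.dependent_finite) auto
  qed
  moreover have "vec.dim (UNIV :: (complex ^ 'n) set) \<le> card (b ` F)"
    by (simp add: card_image[OF inj] F(2) card_cart_basis)
  ultimately have "y \<in> vec.span (b ` F)"
    using vec.card_ge_dim_independent[of "b ` F" UNIV] by blast
  then obtain u where "y = (\<Sum>v\<in>b ` F. u v *s v)"
    using F(1) by (auto simp: vec.span_finite)
  then have "y = combine (ext (u \<circ> b))"
    unfolding ext_combine by (simp add: sum.reindex[OF inj])
  then show ?thesis using ext_sum by blast
qed

text \<open>In the spectral expansion of \<open>combine_exists\<close>, a value of the quadratic form is a convex combination of the points
of the fibre.\<close>

lemma numerical_range_half_plane: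
  assumes "\<And>z. z \<in> fibre w \<Longrightarrow> Re (cnj \<omega> * z) \<le> h" and "p \<in> numerical_range A"
  shows "Re (cnj \<omega> * p) \<le> h"
proof -
  obtain y where y: "norm y = 1" "p = cinner (A *v y) y"
    using assms(2) by (auto simp: numerical_range_def)
  obtain c where c: "(\<Sum>z\<in>fibre w. c z) = 0" "combine c = y" using combine_exists by blast
  define m where "m z = (cmod (c z))\<^sup>2 * weight z" for z
  have m0: "m z \<ge> 0" for z using weight_pos[of z] by (simp add: m_def)
  have "of_real (\<Sum>z\<in>fibre w. m z) = cinner y y"
    using cinner_combine[OF c(1), of c] unfolding c(2) complex_norm_square[symmetric] by (simp add: m_def)
  then have m1: "(\<Sum>z\<in>fibre w. m z) = 1" using y(1) by (simp add: cinner_self flip: of_real_sum)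
  have "p = (\<Sum>z\<in>fibre w. z * (c z * cnj (c z)) * of_real (weight z))"
    using cinner_combine[OF c(1), of "\<lambda>z. z * c z"] unfolding A_combine[OF c(1), symmetric] c(2) y(2)
    by (simp add: mult_ac)
  also have "\<dots> = (\<Sum>z\<in>fibre w. of_real (m z) * z)"
    unfolding complex_norm_square[symmetric] by (simp add: m_def mult_ac)
  finally have "Re (cnj \<omega> * p) = (\<Sum>z\<in>fibre w. Re (of_real (m z) * (cnj \<omega> * z)))"
    by (simp add: sum_distrib_left mult_ac)
  also have "\<dots> = (\<Sum>z\<in>fibre w. m z * Re (cnj \<omega> * z))"
    by (intro sum.cong refl) (simp add: algebra_simps)
  also have "\<dots> \<le> (\<Sum>z\<in>fibre w. m z * h)"
    by (intro sum_mono mult_left_mono assms(1) m0)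
  also have "\<dots> = h" by (simp add: m1 flip: sum_distrib_right)
  finally show ?thesis .
qed

text \<open>Attained at the normalization of \<open>x\<^sub>\<alpha> - x\<^sub>\<beta>\<close>.\<close>

lemma contact_point:
  assumes "\<alpha> \<in> fibre w" "\<beta> \<in> fibre w" "\<alpha> \<noteq> \<beta>"
  shows "(of_real (weight \<alpha>) * \<alpha> + of_real (weight \<beta>) * \<beta>) / of_real (weight \<alpha> + weight \<beta>) \<in> numerical_range A"
proof -
  define y where "y = resolvent_f \<alpha> - resolvent_f \<beta>"
  define W where "W = weight \<alpha> + weight \<beta>"
  have W: "W > 0" using weight_pos by (simp add: W_def add_pos_pos)
  have yy: "cinner y y = of_real W"
    using assms by (simp add: y_def cinner_linear gram_fibre W_def)
  have Ay: "A *v y = \<alpha> *s resolvent_f \<alpha> - \<beta> *s resolvent_f \<beta>"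
    using assms by (simp add: y_def matrix_vector_mult_diff_distrib A_resolvent_f char_poly_nonzero_on_circle norm_fibre)
  have Ayy: "cinner (A *v y) y = of_real (weight \<alpha>) * \<alpha> + of_real (weight \<beta>) * \<beta>"
    unfolding Ay unfolding y_def using assms by (simp add: cinner_linear gram_fibre algebra_simps)
  have ny: "(norm y)\<^sup>2 = W" using yy unfolding cinner_self by (simp only: of_real_eq_iff)
  then have "y \<noteq> 0" using W by auto
  from scaled_quotient_in_numerical_range[OF this, of A] show ?thesis
    unfolding Ayy ny W_def .
qed

end

section \<open>Circular numerical ranges\<close>

text \<open>When \<open>[\<alpha>, \<beta>]\<close> is a side of the polygon, \<open>contact_point\<close> lies on a supporting line of the disk and is the
foot of the perpendicular from \<open>c\<close>. By Pythagoras its distances to \<open>\<alpha>\<close> and \<open>\<beta>\<close> are the tangent lengths; as a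
weighted mean it divides the side in the inverse ratio of the weights.\<close>

lemma weight_balance_on_edge:
  assumes W: "numerical_range A = cball c r" "0 \<le> r"
    and w: "cmod w = 1"
    and \<alpha>\<beta>: "\<alpha> \<in> fibre w" "\<beta> \<in> fibre w" "\<alpha> \<noteq> \<beta>"
    and \<omega>: "cmod \<omega> = 1" "Re (cnj \<omega> * \<alpha>) = h" "Re (cnj \<omega> * \<beta>) = h"
    and side: "\<And>z. z \<in> fibre w \<Longrightarrow> Re (cnj \<omega> * z) \<le> h"
  shows "(weight \<alpha>)\<^sup>2 * ((cmod (\<alpha> - c))\<^sup>2 - r\<^sup>2) = (weight \<beta>)\<^sup>2 * ((cmod (\<beta> - c))\<^sup>2 - r\<^sup>2)"
proof -
  define S where "S = weight \<alpha> + weight \<beta>"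
  have S: "S > 0" using weight_pos by (simp add: S_def add_pos_pos)
  define s t where "s = weight \<alpha> / S" and "t = weight \<beta> / S"
  have st: "s + t = 1" using S by (simp add: s_def t_def S_def flip: add_divide_distrib)
  define p where "p = of_real s * \<alpha> + of_real t * \<beta>"
  have pW: "p \<in> cball c r"
    using contact_point[OF w \<alpha>\<beta>] unfolding W(1) p_def s_def t_def S_def
    by (simp add: add_divide_distrib)
  have split: "(cmod (u + of_real x * \<omega>))\<^sup>2 = (cmod u)\<^sup>2 + 2 * x * Re (cnj \<omega> * u) + x\<^sup>2" for u x
  proof -
    have "(cmod (u + of_real x * \<omega>))\<^sup>2 = (cmod u)\<^sup>2 + 2 * x * Re (cnj \<omega> * u) + x\<^sup>2 * (cmod \<omega>)\<^sup>2"
      unfolding cmod_power2 by (simp add: power2_eq_square algebra_simps)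
    then show ?thesis using \<omega>(1) by simp
  qed
  have "Re (cnj \<omega> * p) = s * Re (cnj \<omega> * \<alpha>) + t * Re (cnj \<omega> * \<beta>)"
    by (simp add: p_def algebra_simps)
  also have "\<dots> = (s + t) * h" using \<omega> by (simp add: algebra_simps)
  finally have ph: "Re (cnj \<omega> * p) = h" using st by simp
  have "c + of_real r * \<omega> \<in> numerical_range A"
    unfolding W(1) using \<omega>(1) W(2) by (simp add: dist_norm norm_mult)
  from numerical_range_half_plane[OF w side this]
  have "Re (cnj \<omega> * (c + of_real r * \<omega>)) \<le> h" .
  moreover have "Re (cnj \<omega> * (c + of_real r * \<omega>)) = Re (cnj \<omega> * c) + r"
  proof -
    have "cnj \<omega> * (c + of_real r * \<omega>) = cnj \<omega> * c + of_real r * (\<omega> * cnj \<omega>)"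
      by (simp add: algebra_simps)
    then show ?thesis by (simp only: unimodular_mult_cnj[OF \<omega>(1)]) simp
  qed
  ultimately have "r \<le> Re (cnj \<omega> * (p - c))" using ph by (simp add: algebra_simps)
  from disk_support_point[OF \<omega>(1) pW W(2) this] have pc: "p - c = of_real r * \<omega>" by simp
  \<comment> \<open>Pythagoras for the triangle with the vertices \<open>c\<close>, \<open>p\<close> and \<open>v\<close>.\<close>
  have tangent: "(cmod (v - c))\<^sup>2 - r\<^sup>2 = (cmod (v - p))\<^sup>2" if "Re (cnj \<omega> * v) = h" for v
  proof -
    have vc: "v - c = (v - p) + of_real r * \<omega>" using pc by (simp add: algebra_simps)
    have perp: "Re (cnj \<omega> * (v - p)) = 0" using that ph by (simp add: algebra_simps)
    show ?thesis unfolding vc split perp by simp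
  qed
  have st': "of_real s + of_real t = (1 :: complex)" using st by (simp flip: of_real_add)
  have "\<alpha> - p = (of_real s + of_real t) * \<alpha> - p" by (simp only: st' mult_1_left)
  then have \<alpha>p: "\<alpha> - p = of_real t * (\<alpha> - \<beta>)" by (simp add: p_def algebra_simps)
  have "\<beta> - p = (of_real s + of_real t) * \<beta> - p" by (simp only: st' mult_1_left)
  then have \<beta>p: "\<beta> - p = of_real s * (\<beta> - \<alpha>)" by (simp add: p_def algebra_simps)
  show ?thesis
    unfolding tangent[OF \<omega>(2)] tangent[OF \<omega>(3)] \<alpha>p \<beta>p
    by (simp only: norm_mult power_mult_distrib norm_of_real power2_abs norm_minus_commute[of \<beta> \<alpha>]
        s_def t_def power_divide) simp
qed

lemma weight_balance_on_fibre:
  assumes W: "numerical_range A = cball c r" "0 \<le> r"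
    and w: "cmod w = 1"
    and \<alpha>\<beta>: "\<alpha> \<in> fibre w" "\<beta> \<in> fibre w"
  shows "(weight \<alpha>)\<^sup>2 * ((cmod (\<alpha> - c))\<^sup>2 - r\<^sup>2) = (weight \<beta>)\<^sup>2 * ((cmod (\<beta> - c))\<^sup>2 - r\<^sup>2)"
proof -
  define g where "g t = (weight (cis t))\<^sup>2 * ((cmod (cis t - c))\<^sup>2 - r\<^sup>2)" for t
  have cis_Arg: "cis (Arg2pi z) = z" if "z \<in> fibre w" for z
    using Arg2pi_eq[of z] norm_fibre[OF w that] by (simp add: cis_conv_exp)
  have "g (Arg2pi \<alpha>) = g (Arg2pi \<beta>)"
  proof (rule constant_on_finite_chain[where T = "Arg2pi ` fibre w" and f = g])
    show "finite (Arg2pi ` fibre w)" by (intro finite_imageI finite_fibre w)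
    show "Arg2pi \<alpha> \<in> Arg2pi ` fibre w" "Arg2pi \<beta> \<in> Arg2pi ` fibre w" using \<alpha>\<beta> by auto
    fix s t
    assume s: "s \<in> Arg2pi ` fibre w" and t: "t \<in> Arg2pi ` fibre w" and less: "s < t"
      and gap: "\<forall>v\<in>Arg2pi ` fibre w. v \<le> s \<or> t \<le> v"
    \<comment> \<open>The side between neighbouring vertices has the outer normal \<open>cis m\<close> and the signed distance \<open>cos d\<close> from the origin.\<close>
    define m d where "m = (s + t) / 2" and "d = (t - s) / 2"
    have range: "0 \<le> v \<and> v < 2 * pi" if "v \<in> Arg2pi ` fibre w" for v
      using that Arg2pi by auto
    have d: "0 < d" "d < pi" using less range[OF s] range[OF t] by (auto simp: d_def)
    have Re: "Re (cnj (cis m) * cis v) = cos (v - m)" for v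
      by (simp add: cos_diff mult.commute)
    have fib: "cis v \<in> fibre w \<and> Arg2pi (cis v) = v" if "v \<in> Arg2pi ` fibre w" for v
      using that cis_Arg by force
    have ne: "cis s \<noteq> cis t" using fib[OF s] fib[OF t] less by force
    have sm: "cos (s - m) = cos d" "cos (t - m) = cos d"
    proof -
      have "s - m = - d" "t - m = d" by (simp_all add: m_def d_def field_simps)
      then show "cos (s - m) = cos d" "cos (t - m) = cos d" by simp_all
    qed
    have vm: "cos (v - m) \<le> cos d" if v: "v \<in> Arg2pi ` fibre w" for v
    proof (rule cos_le_cos_outside[OF d])
      have "v \<le> s \<or> t \<le> v" using gap v by blast
      then show "d \<le> \<bar>v - m\<bar>" unfolding d_def m_def using less by (auto simp: abs_if field_simps)
      show "\<bar>v - m\<bar> \<le> 2 * pi - d"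
        using range[OF v] range[OF s] range[OF t] less by (auto simp: d_def m_def field_simps abs_if)
    qed
    show "g s = g t"
      unfolding g_def
    proof (rule weight_balance_on_edge[OF W w _ _ ne, where \<omega> = "cis m" and h = "cos d"])
      show "cis s \<in> fibre w" "cis t \<in> fibre w" using fib s t by blast+
      show "Re (cnj (cis m) * cis s) = cos d" "Re (cnj (cis m) * cis t) = cos d"
        unfolding Re by (rule sm)+
      fix z assume z: "z \<in> fibre w"
      then have "Re (cnj (cis m) * cis (Arg2pi z)) \<le> cos d"
        unfolding Re by (intro vm imageI)
      then show "Re (cnj (cis m) * z) \<le> cos d" by (simp only: cis_Arg[OF z])
    qed simp
  qed
  then show ?thesis using \<alpha>\<beta> by (simp add: g_def cis_Arg)
qed

text \<open>Write \<open>a = z^k b\<close> with \<open>b(0) \<noteq> 0\<close>. Then \<open>u = U / (b denom)\<close> on the circle for a polynomial \<open>U\<close>, and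
\<open>\<bar>z - c\<bar>\<^sup>2 - r\<^sup>2\<close> is \<open>((z - c)(1 - cnj c z) - r\<^sup>2 z) / z\<close> there. So \<open>R = X / Y\<close>, where \<open>Y\<close> has a simple zero at \<open>0\<close>
and \<open>X(0)\<close> is a nonzero multiple of \<open>c\<close>. By \<open>jet_of_fibre_constant\<close>, \<open>X(0)\<close> must be zero.\<close>

lemma center_eq_0:
  assumes W: "numerical_range A = cball c r" "0 \<le> r"
  shows "c = 0"
proof -
  obtain b k where b: "a = [:0, 1:] ^ k * b" and b0: "poly b 0 \<noteq> 0"
  proof -
    obtain b where b: "a = [:- 0, 1:] ^ order 0 a * b" "\<not> [:- 0, 1:] dvd b"
      using order_decomp[OF a_nonzero, of 0] by (elim exE conjE)
    show thesis
    proof (rule that)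
      show "a = [:0, 1:] ^ order 0 a * b" using b(1) unfolding minus_zero .
      show "poly b 0 \<noteq> 0" using b(2) by (simp add: poly_eq_0_iff_dvd)
    qed
  qed
  define U where "U = smult (of_nat (Suc k)) (b * denom) + [:0, 1:] * (pderiv b * denom - b * pderiv denom)"
  define X where "X = U ^ 2 * ([:- c, 1:] * [:1, - cnj c:] - [:0, of_real (r\<^sup>2):])"
  define Y where "Y = pCons 0 (b ^ 2 * denom ^ 2)"
  have a: "poly a z = z ^ k * poly b z" for z
    by (simp add: b)
  have da: "z * poly (pderiv a) z = z ^ k * (of_nat k * poly b z + z * poly (pderiv b) z)" for z
  proof -
    have "z * poly (pderiv ([:0, 1:] ^ n)) z = of_nat n * z ^ n" for n
      by (induction n) (simp_all add: pderiv_mult pderiv_pCons algebra_simps)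
    then show ?thesis unfolding b by (simp add: pderiv_mult algebra_simps)
  qed
  have U: "poly U z = of_real (weight z) * poly b z * poly denom z" if z: "cmod z = 1" for z
  proof -
    have "z ^ k * (of_real (weight z) * poly b z * poly denom z) = z ^ k * poly U z"
    proof -
      have "poly U z = (of_nat k + 1) * (poly b z * poly denom z)
          + z * (poly (pderiv b) z * poly denom z - poly b z * poly (pderiv denom) z)"
        by (simp add: U_def algebra_simps)
      \<comment> \<open>The ring identity is stated with \<open>Z\<close> for \<open>z^k\<close>, since the exponent is symbolic.\<close>
      moreover have "Z * (W * B * R) = Z * V"
        if "V = (K + 1) * (B * R) + z * (B' * R - B * R')"
          and "W * (Z * B) * R = Z * B * R + z * (A' * R - Z * B * R')"
          and "z * A' = Z * (K * B + z * B')"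
        for Z W B R V K B' R' A' :: complex
        using that by algebra
      ultimately show ?thesis using weight_eq[OF z, unfolded a] da[of z] by blast
    qed
    moreover have "z ^ k \<noteq> 0" using z by auto
    ultimately show ?thesis by (metis mult_left_cancel)
  qed
  have XY: "poly X z = of_real ((weight z)\<^sup>2 * ((cmod (z - c))\<^sup>2 - r\<^sup>2)) * poly Y z"
    if z: "cmod z = 1" for z
  proof -
    have "(z - c) * (1 - cnj c * z) - of_real (r\<^sup>2) * z = z * ((z - c) * cnj (z - c) - of_real (r\<^sup>2)) + (z - c) * (1 - z * cnj z)"
      by (simp add: algebra_simps)
    also have "\<dots> = z * of_real ((cmod (z - c))\<^sup>2 - r\<^sup>2)"
      unfolding complex_norm_square[symmetric] by (simp add: z)
    finally have circle: "(z - c) * (1 - cnj c * z) - of_real (r\<^sup>2) * z = z * of_real ((cmod (z - c))\<^sup>2 - r\<^sup>2)" .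
    have "poly X z = (poly U z)\<^sup>2 * ((z - c) * (1 - cnj c * z) - of_real (r\<^sup>2) * z)"
      by (simp add: X_def algebra_simps)
    then have "poly X z = (poly U z)\<^sup>2 * (z * of_real ((cmod (z - c))\<^sup>2 - r\<^sup>2))"
      by (simp only: circle)
    then show ?thesis by (simp add: U[OF z] Y_def power_mult_distrib mult_ac)
  qed
  have "coeff X 0 * coeff Y 1 = coeff X 1 * coeff Y 0"
  proof (rule jet_of_fibre_constant)
    show "degree denom < degree numer" using degree_denom by (simp add: degree_numer)
    show "lead_coeff numer = 1" by (rule lead_coeff_numer)
    show "coeff numer 0 = 0" "coeff numer 1 = 0"
      using poly_a_0 by (simp_all add: numer_def poly_0_coeff_0)
    show "infinite {w :: complex. cmod w = 1}" by (rule infinite_unit_circle)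
    fix w :: complex assume "w \<in> {w. cmod w = 1}"
    then have w: "cmod w = 1" by simp
    show "poly (pderiv (numer - smult w denom)) z \<noteq> 0" if "poly (numer - smult w denom) z = 0" for z
      using fibre_simple[OF w] that by (simp add: fibre_def)
    obtain p where p: "p \<in> fibre w" using card_fibre[OF w] by force
    have "poly X z = of_real ((weight p)\<^sup>2 * ((cmod (p - c))\<^sup>2 - r\<^sup>2)) * poly Y z"
      if "poly (numer - smult w denom) z = 0" for z
    proof -
      have z: "z \<in> fibre w" using that by (simp add: fibre_def)
      show ?thesis
        unfolding weight_balance_on_fibre[OF W w p z] by (rule XY[OF norm_fibre[OF w z]])
    qed
    then show "\<exists>k. \<forall>z. poly (numer - smult w denom) z = 0 \<longrightarrow> poly X z = k * poly Y z" by blast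
  qed
  moreover have "coeff Y 0 = 0" "coeff Y 1 = (poly b 0)\<^sup>2 * (poly denom 0)\<^sup>2"
    by (simp_all add: Y_def poly_0_coeff_0[symmetric])
  moreover have "coeff X 0 = (of_nat (Suc k) * (poly b 0 * poly denom 0))\<^sup>2 * (- c)"
    by (simp add: X_def U_def poly_0_coeff_0[symmetric] del: of_nat_Suc)
  ultimately have "(of_nat (Suc k) * (poly b 0 * poly denom 0))\<^sup>2 * (- c) * ((poly b 0)\<^sup>2 * (poly denom 0)\<^sup>2) = 0"
    by simp
  then show ?thesis using b0 poly_denom_0 by (simp del: of_nat_Suc)
qed

end

theorem theorem1:
  fixes A :: "complex ^ 'n ^ 'n" and c :: complex and r :: real
  assumes "partial_isometry A"
    and "vec.dim (mat_ker A) = 1"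
    and "0 \<le> r"
    and "numerical_range A = cball c r"
  shows "c = 0"
proof (rule ccontr)
  assume c: "c \<noteq> 0"
  obtain e f where "defect_one A e f" using partial_isometry_defect_one[OF assms(1,2)] by blast
  then interpret defect_one A e f .
  interpret defect_one_no_unimodular A e f
    using no_unimodular_eigenvalue_if_disk[OF assms(4,3) c] by unfold_locales
  show False using center_eq_0[OF assms(4,3)] c by blast
qed

end
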